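(* Let $u\in\mathbb{C}$ and let $\mathcal{A}\in\mathbb{C}[q_0]((\hbar))[[q_1+1,q_2,\dots]]$ be a formal power series. If $$\frac{1}{\sqrt{\lambda-u}}\Bigl(\Gamma^{\alpha/2}(u,\lambda)\otimes\Gamma^{-\alpha/2}(u,\lambda)-\Gamma^{-\alpha/2}(u,\lambda)\otimes\Gamma^{\alpha/2}(u,\lambda)\Bigr)\,\mathcal{A}\otimes\mathcal{A}$$ is regular in $\lambda$, then $$\Omega^{\rm KW}(u,\lambda)\,\mathcal{A}\otimes\mathcal{A}$$ is regular in $\lambda$. (The first condition is the KP-reduction form of the KdV hierarchy, the second one is the full system of bilinear equations extending the Kac--Wakimoto form of the KdV hierarchy.)
   Context: "Regular in $\lambda$" means that all coefficients of the formal series (in front of the monomials in $\mathbf{q}'$, $\mathbf{q}''$, $\hbar$) are polynomials in $\lambda$. For $n\in\mathbb{Z}$ put $$I^{(n)}_\alpha(u,\lambda)=\sqrt{2\pi}\,\frac{(\lambda-u)^{-n-\frac12}}{\Gamma(-n+\frac12)} .$$ For $c\in\mathbb{C}$ define the vertex operator $$\Gamma^{c\alpha}(u,\lambda)=\exp\Bigl(c\sum_{k\ge0}I^{(-k-1)}_\alpha(u,\lambda)\frac{q_k}{\sqrt\hbar}\Bigr)\exp\Bigl(c\sum_{k\ge0}(-1)^{k+1}I^{(k)}_\alpha(u,\lambda)\sqrt\hbar\,\frac{\partial}{\partial q_k}\Bigr),$$ and let $$\phi_\alpha(u,\lambda)=\sum_{k\ge0}\Bigl(I^{(-k)}_\alpha(u,\lambda)\frac{q_k}{\sqrt\hbar}+(-1)^{k+1}I^{(k+1)}_\alpha(u,\lambda)\sqrt\hbar\,\frac{\partial}{\partial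 q_k}\Bigr).$$ In tensor products the first factor acts on functions of $\mathbf{q}'$ and the second on functions of $\mathbf{q}''$; $\mathcal{A}\otimes\mathcal{A}=\mathcal{A}(\hbar,\mathbf{q}')\mathcal{A}(\hbar,\mathbf{q}'')$. $:\ :$ denotes normal ordering (derivatives to the right). Define $$\Omega^{\rm KW}(u,\lambda)=\frac{1}{16(\lambda-u)^2}\Bigl(\Gamma^{\alpha}(u,\lambda)\otimes\Gamma^{-\alpha}(u,\lambda)+\Gamma^{-\alpha}(u,\lambda)\otimes\Gamma^{\alpha}(u,\lambda)\Bigr)-L(u,\lambda),$$ $$L(u,\lambda)=\frac14:\bigl(\phi_\alpha(u,\lambda)\otimes1-1\otimes\phi_\alpha(u,\lambda)\bigr)^2:+\frac{1}{8(\lambda-u)^2}.$$ *)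

theory Defs
  imports
    "HOL-Analysis.Analysis"
    "HOL-Computational_Algebra.Computational_Algebra"
    "HOL-Library.Poly_Mapping"
begin

text \<open>
  The half-integer powers of \<open>\<lambda> - u\<close> and of \<open>\<hbar>\<close> are treated formally.  The coefficient ring is
  \<open>\<complex>((h))((w))\<close> with \<open>h = \<surd>\<hbar>\<close> (inner variable) and \<open>w = (\<lambda> - u)\<^sup>-\<^sup>1\<^sup>/\<^sup>2\<close> (outer variable),
  so \<open>\<lambda> = u + w\<^sup>-\<^sup>2\<close>.  The derivative parts of the vertex operators produce infinitely many
  negative powers of \<open>\<lambda> - u\<close>, and for each fixed power of \<open>\<lambda> - u\<close> a Laurent series in \<open>h\<close>
  (with no lower bound on its order uniform in the power of \<open>\<lambda> - u\<close>).
  Infinite sums (\<^const>\<open>suminf\<close>) in this ring refer to the topology of the library on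
  formal Laurent series, i.e. the \<open>w\<close>-adic one.

  A monomial is a finitely supported exponent function \<open>m\<close>; the exponent \<open>m k\<close> belongs to the
  variable \<open>x\<^sub>k\<close>, where \<open>x\<^sub>1 = q\<^sub>1 + 1\<close> and \<open>x\<^sub>k = q\<^sub>k\<close> for \<open>k \<noteq> 1\<close>.  A formal power series is its
  coefficient function.
\<close>

type_synonym coef = "complex fls fls"
type_synonym mono = "nat \<Rightarrow>\<^sub>0 nat"
type_synonym series = "mono \<Rightarrow> coef"              (* functions of q *)
type_synonym series2 = "mono \<Rightarrow> mono \<Rightarrow> coef"    (* functions of q' and q'' *)

definition cst :: "complex \<Rightarrow> coef" where
  "cst c = fls_const (fls_const c)"

definition sqrt_hbar :: coef where
  "sqrt_hbar = fls_const fls_X"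

definition w_power :: "int \<Rightarrow> coef" where
  "w_power n = fls_X_intpow n"

text \<open>The space \<open>\<complex>[q\<^sub>0]((\<hbar>))[[q\<^sub>1+1, q\<^sub>2, \<dots>]]\<close>: \<open>A m\<close> is the coefficient of the monomial \<open>m\<close>, a Laurent
  series in \<open>\<hbar>\<close>; collecting the powers of \<open>q\<^sub>0\<close> in front of a monomial in the other variables
  has to give an element of \<open>\<complex>[q\<^sub>0]((\<hbar>))\<close>.\<close>

definition formal_functions :: "(mono \<Rightarrow> complex fls) set" where
  "formal_functions = {A. \<forall>m. Poly_Mapping.lookup m 0 = 0 \<longrightarrow>
     (\<exists>f :: complex poly fls. \<forall>i n.
        fls_nth (A (m + Poly_Mapping.single 0 i)) n = coeff (fls_nth f n) i)}"

definition tensor_square :: "(mono \<Rightarrow> complex fls) \<Rightarrow> series2" where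
  "tensor_square A = (\<lambda>m' m''. fls_const (fls_compose_power (A m' * A m'') 2))"
    \<comment> \<open>\<open>\<hbar> = h\<^sup>2\<close>\<close>

text \<open>The period \<open>I\<^sup>(\<^sup>n\<^sup>)(u,\<lambda>)\<close>, where \<open>(\<lambda> - u)\<^sup>-\<^sup>n\<^sup>-\<^sup>1\<^sup>/\<^sup>2 = w\<^sup>2\<^sup>n\<^sup>+\<^sup>1\<close>.\<close>

definition period :: "int \<Rightarrow> coef" where
  "period n = cst (complex_of_real (sqrt (2 * pi)) / Gamma (1/2 - of_int n)) * w_power (2 * n + 1)"

text \<open>Multiplication by \<open>q\<^sub>k\<close> (that is \<open>x\<^sub>k\<close>, or \<open>x\<^sub>1 - 1\<close> if \<open>k = 1\<close>) and \<open>\<partial>/\<partial>q\<^sub>k\<close>.\<close>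

definition mult_q :: "nat \<Rightarrow> series \<Rightarrow> series" where
  "mult_q k G = (\<lambda>m. (if Poly_Mapping.lookup m k > 0 then G (m - Poly_Mapping.single k 1) else 0)
                     - (if k = 1 then G m else 0))"

definition deriv_q :: "nat \<Rightarrow> series \<Rightarrow> series" where
  "deriv_q k G = (\<lambda>m. of_nat (Poly_Mapping.lookup m k + 1) * G (m + Poly_Mapping.single k 1))"

text \<open>\<open>\<Sum>\<^sub>k J\<^sub>k q\<^sub>k / \<surd>\<hbar>\<close> and \<open>\<Sum>\<^sub>k (-1)\<^sup>k\<^sup>+\<^sup>1 J\<^sub>k \<surd>\<hbar> \<partial>/\<partial>q\<^sub>k\<close>.\<close>

definition mult_part :: "(nat \<Rightarrow> coef) \<Rightarrow> series \<Rightarrow> series" where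
  "mult_part J G = (\<lambda>m. suminf (\<lambda>k. J k / sqrt_hbar * mult_q k G m))"

definition deriv_part :: "(nat \<Rightarrow> coef) \<Rightarrow> series \<Rightarrow> series" where
  "deriv_part J G = (\<lambda>m. suminf (\<lambda>k. (- 1) ^ (k + 1) * J k * sqrt_hbar * deriv_q k G m))"

text \<open>\<open>(c\<^sub>1 T) \<otimes> 1 + 1 \<otimes> (c\<^sub>2 T)\<close>\<close>

definition on_factors :: "complex \<Rightarrow> complex \<Rightarrow> (series \<Rightarrow> series) \<Rightarrow> series2 \<Rightarrow> series2" where
  "on_factors c1 c2 T F = (\<lambda>m' m''. cst c1 * T (\<lambda>m. F m m'') m' + cst c2 * T (F m') m'')"

definition op_exp :: "(series2 \<Rightarrow> series2) \<Rightarrow> series2 \<Rightarrow> series2" where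
  "op_exp T F = (\<lambda>m' m''. suminf (\<lambda>n. cst (1 / fact n) * (T ^^ n) F m' m''))"

text \<open>
  \<open>\<Gamma>\<^sup>c\<^sup>1\<^sup>\<alpha> \<otimes> \<Gamma>\<^sup>c\<^sup>2\<^sup>\<alpha>\<close>.  Operators acting on different factors commute, so the two multiplication
  exponentials are written as one, and so are the two derivative exponentials.  This matters:
  because of the shift \<open>q\<^sub>1 = x\<^sub>1 - 1\<close>, a single factor contains the constant
  \<open>exp (- c I\<^sup>(\<^sup>-\<^sup>2\<^sup>) / \<surd>\<hbar>)\<close>, which has infinitely many positive powers of \<open>\<lambda> - u\<close>.  These constants
  cancel in the exponent when \<open>c\<^sub>1 + c\<^sub>2 = 0\<close>, the only case that is used (in the other cases the
  series below diverges).
\<close>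

definition vertex2 :: "complex \<Rightarrow> complex \<Rightarrow> series2 \<Rightarrow> series2" where
  "vertex2 c1 c2 F =
     op_exp (on_factors c1 c2 (mult_part (\<lambda>k. period (- int k - 1))))
       (op_exp (on_factors c1 c2 (deriv_part (\<lambda>k. period (int k)))) F)"

text \<open>The multiplication part and the derivative part of \<open>\<phi> \<otimes> 1 - 1 \<otimes> \<phi>\<close>, and the normally ordered
  square \<open>:(P + D)\<^sup>2: = P\<^sup>2 + 2PD + D\<^sup>2\<close>.\<close>

definition phi_mult :: "series2 \<Rightarrow> series2" where
  "phi_mult = on_factors 1 (- 1) (mult_part (\<lambda>k. period (- int k)))"

definition phi_deriv :: "series2 \<Rightarrow> series2" where
  "phi_deriv = on_factors 1 (- 1) (deriv_part (\<lambda>k. period (int k + 1)))"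

definition phi_normal_square :: "series2 \<Rightarrow> series2" where
  "phi_normal_square F = (\<lambda>m' m''.
     phi_mult (phi_mult F) m' m'' + 2 * phi_mult (phi_deriv F) m' m''
       + phi_deriv (phi_deriv F) m' m'')"

text \<open>Below, \<open>1/(\<lambda> - u)\<^sup>2 = w\<^sup>4\<close> and \<open>1/\<surd>(\<lambda> - u) = w\<close>.\<close>

definition L_op :: "series2 \<Rightarrow> series2" where
  "L_op F = (\<lambda>m' m''. cst (1/4) * phi_normal_square F m' m'' + cst (1/8) * w_power 4 * F m' m'')"

definition Omega_KW :: "series2 \<Rightarrow> series2" where
  "Omega_KW F = (\<lambda>m' m''.
     cst (1/16) * w_power 4 * (vertex2 1 (- 1) F m' m'' + vertex2 (- 1) 1 F m' m'')
       - L_op F m' m'')"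

definition KP_reduction :: "series2 \<Rightarrow> series2" where
  "KP_reduction F = (\<lambda>m' m''.
     w_power 1 * (vertex2 (1/2) (- 1/2) F m' m'' - vertex2 (- 1/2) (1/2) F m' m''))"

text \<open>\<open>F\<close> is regular in \<open>\<lambda>\<close>: the coefficient of each monomial in \<open>q'\<close>, \<open>q''\<close> and each power \<open>h\<^sup>n\<close>, a
  Laurent series in \<open>w\<close>, is a polynomial in \<open>\<lambda> = u + w\<^sup>-\<^sup>2\<close>.\<close>

definition lambda_var :: "complex \<Rightarrow> complex fls" where
  "lambda_var u = fls_const u + fls_X_intpow (- 2)"

definition regular_in_lambda :: "complex \<Rightarrow> series2 \<Rightarrow> bool" where
  "regular_in_lambda u F \<longleftrightarrow>
     (\<forall>m' m'' n. \<exists>p :: complex poly. \<forall>j.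
        fls_nth (fls_nth (F m' m'') j) n = fls_nth (poly (map_poly fls_const p) (lambda_var u)) j)"

end

theory Submission
  imports Defs
begin

text \<open>
  Put \<open>z = \<surd>(\<lambda> - u) = w\<^sup>-\<^sup>1\<close>.  As \<open>c\<^sub>1 + c\<^sub>2 = 0\<close>, all operators act on \<open>q' - q''\<close> only, and
  \<open>X(z) = \<Gamma>\<^sup>\<alpha>\<^sup>/\<^sup>2 \<otimes> \<Gamma>\<^sup>-\<^sup>\<alpha>\<^sup>/\<^sup>2 = M(z) E(z)\<close> is a product of exponentials of odd series \<open>B(z)\<close> and \<open>A(z)\<close> of
  creation and annihilation operators with \<open>X(z) X(y) = (z - y)/(z + y) :X(z) X(y):\<close>.  The hypothesis
  says that the odd part of \<open>X(y) F\<close> has only positive powers of \<open>y\<close>.  Hence so does the part of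
  \<open>(z\<^sup>2 - y\<^sup>2) X(z) X(y) F\<close> that is odd in \<open>z\<close> and in \<open>y\<close>.  This part is also the odd part of
  \<open>(z - y)\<^sup>2 :X(z) X(y): F\<close>, which is symmetric, so it is \<open>zy P(z\<^sup>2, y\<^sup>2)\<close> with a polynomial \<open>P\<close>.  From
  \<open>:X(z) X(z): = \<Gamma>\<^sup>\<alpha> \<otimes> \<Gamma>\<^sup>-\<^sup>\<alpha>\<close> and \<open>:X(z) X(-z): = 1\<close> one computes that \<open>\<Omega> F\<close> is the restriction
  of \<open>- \<partial>\<^sub>\<lambda> \<partial>\<^sub>\<mu> P(\<lambda>, \<mu>) / 2\<close> to the diagonal.
\<close>

unbundle no vec_syntax
unbundle fps_syntax

subsection \<open>Endomorphisms of function spaces and the Euler operator\<close>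

text \<open>The obstacle is convergence: M(z) has infinitely many positive and E(z) infinitely many
  negative powers of z, so X(z) X(y) makes sense only through its values at single monomials. Giving
  x_k the weight 2k + 1, the power of z that accompanies it, makes all operators homogeneous, and
  each coefficient at a fixed monomial becomes a finite sum bounded by the weight. Hence the
  argument runs on coefficients, with the denominator of (z - y)/(z + y) cleared. The ring of
  operators is not commutative, so products of exponentials are identified through the equation z f'
  = a f. Why the mixed derivative yields \<Omega>: on the diagonal (z - y)^2/(zy) vanishes to second
  order with mixed derivative -2/z^2, which leaves the vertex operators. In the odd part, :X(-z)
  X(y): is multiplied by (z + y)^2/(zy), which is stationary on the diagonal; it leaves the constant
  1/(8(\<lambda> - u)^2) and a product of two first derivatives of the exponent, the square of
  \<phi> \<otimes> 1 - 1 \<otimes> \<phi>.\<close>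

typedef (overloaded) ('i, 'k::field_char_0) endo =
  "{T :: ('i \<Rightarrow> 'k) \<Rightarrow> 'i \<Rightarrow> 'k.
     (\<forall>F G. T (\<lambda>i. F i + G i) = (\<lambda>i. T F i + T G i)) \<and> (\<forall>c F. T (\<lambda>i. c * F i) = (\<lambda>i. c * T F i))}"
  morphisms app Abs_endo
  by (rule exI[of _ "\<lambda>F. F"]) auto

setup_lifting type_definition_endo

instantiation endo :: (type, field_char_0) ring_1
begin
lift_definition zero_endo :: "('a, 'b) endo" is "\<lambda>F i. 0" by auto
lift_definition one_endo :: "('a, 'b) endo" is "\<lambda>F. F" by auto
lift_definition plus_endo :: "('a, 'b) endo \<Rightarrow> ('a, 'b) endo \<Rightarrow> ('a, 'b) endo"
  is "\<lambda>S T F i. S F i + T F i" by (auto simp: fun_eq_iff algebra_simps)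
lift_definition minus_endo :: "('a, 'b) endo \<Rightarrow> ('a, 'b) endo \<Rightarrow> ('a, 'b) endo"
  is "\<lambda>S T F i. S F i - T F i" by (auto simp: fun_eq_iff algebra_simps)
lift_definition uminus_endo :: "('a, 'b) endo \<Rightarrow> ('a, 'b) endo"
  is "\<lambda>T F i. - T F i" by (auto simp: fun_eq_iff algebra_simps)
lift_definition times_endo :: "('a, 'b) endo \<Rightarrow> ('a, 'b) endo \<Rightarrow> ('a, 'b) endo"
  is "\<lambda>S T F. S (T F)" by auto
lemma app_0 [simp]: "app 0 F i = 0" by transfer simp
lemma app_1 [simp]: "app 1 F = F" by transfer simp
lemma app_add: "app (S + T) F i = app S F i + app T F i" by transfer simp
lemma app_diff: "app (S - T) F i = app S F i - app T F i" by transfer simp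
lemma app_uminus: "app (- T) F i = - app T F i" by transfer simp
lemma app_mult: "app (S * T) F = app S (app T F)" by transfer simp

lemma app_arg_add: "app T (\<lambda>i. F i + G i) i = app T F i + app T G i"
  by transfer (auto simp: fun_eq_iff)

lemma endo_eqI: "(\<And>F i. app S F i = app T F i) \<Longrightarrow> S = T"
  by transfer (auto simp: fun_eq_iff)

instance
proof
  fix a b c :: "('a, 'b) endo"
  show "a + b + c = a + (b + c)" "a + b = b + a" "0 + a = a" "- a + a = 0" "a - b = a + - b"
    "a * b * c = a * (b * c)" "(a + b) * c = a * c + b * c" "1 * a = a" "a * 1 = a"
    by (rule endo_eqI; simp add: app_add app_diff app_uminus app_mult)+
  show "a * (b + c) = a * b + a * c"
    by (rule endo_eqI) (simp add: app_add app_mult app_add[of b c, abs_def] app_arg_add)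
  have "app 0 (\<lambda>i. 1) i \<noteq> app (1::('a, 'b) endo) (\<lambda>i. 1) i" for i by simp
  then show "(0::('a, 'b) endo) \<noteq> 1" by metis
qed
end

lift_definition scal :: "'k \<Rightarrow> ('i, 'k::field_char_0) endo" is "\<lambda>c F i. c * F i"
  by (auto simp: fun_eq_iff algebra_simps)

lemma app_scal: "app (scal c) F i = c * F i" by transfer simp
lemma app_sum: "app (sum T A) F i = (\<Sum>x\<in>A. app (T x) F i)"
  by (induction A rule: infinite_finite_induct) (auto simp: app_add)

lemma app_arg_scale: "app T (\<lambda>i. c * F i) i = c * app T F i"
  by transfer (auto simp: fun_eq_iff)
lemma app_arg_0 [simp]: "app T (\<lambda>i. 0) i = 0"
  using app_arg_scale[of T 0 "\<lambda>i. 0" i] by simp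
lemma app_arg_diff: "app T (\<lambda>i. F i - G i) i = app T F i - app T G i"
  using app_arg_add[of T F "\<lambda>i. (- 1) * G i" i] app_arg_scale[of T "- 1" G i] by simp
lemma app_arg_sum: "app T (\<lambda>i. \<Sum>x\<in>A. F x i) i = (\<Sum>x\<in>A. app T (F x) i)"
  by (induction A rule: infinite_finite_induct) (auto simp: app_arg_add)

lemma scal_commute: "scal c * T = T * scal c"
  by (rule endo_eqI) (simp add: app_mult app_scal[abs_def] app_arg_scale)
lemma scal_mult: "scal (a * b) = scal a * scal b"
  by (rule endo_eqI) (simp add: app_mult app_scal)
lemma scal_add: "scal (a + b) = scal a + scal b"
  by (rule endo_eqI) (simp add: app_add app_scal algebra_simps)
lemma scal_1 [simp]: "scal 1 = 1"
  by (rule endo_eqI) (simp add: app_scal)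
lemma scal_0 [simp]: "scal 0 = 0"
  by (rule endo_eqI) (simp add: app_scal)
lemma scal_uminus: "scal (- a) = - scal a"
  by (rule endo_eqI) (simp add: app_scal app_uminus)
lemma scal_of_nat: "scal (of_nat n) = of_nat n"
  by (induction n) (auto simp: scal_add)

lemma of_nat_mult_endo_eq_0:
  fixes x :: "('i, 'k::field_char_0) endo"
  assumes "of_nat (Suc n) * x = 0"
  shows "x = 0"
proof -
  have "scal (1 / of_nat (Suc n)) * (of_nat (Suc n) * x) = x"
    unfolding scal_of_nat[symmetric] mult.assoc[symmetric] scal_mult[symmetric]
    by (simp del: of_nat_Suc)
  with assms show ?thesis by simp
qed

section \<open>The operator z d/dz and uniqueness for \<open>euler Y = a * Y\<close>\<close>

definition euler :: "'a::semiring_1 fps \<Rightarrow> 'a fps" where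
  "euler f = Abs_fps (\<lambda>n. of_nat n * f $ n)"

lemma euler_nth [simp]: "euler f $ n = of_nat n * f $ n"
  by (simp add: euler_def)

lemma euler_mult: "euler (f * g) = euler f * g + f * euler g"
proof (rule fps_ext)
  fix n
  have "of_nat n * (f $ i * g $ (n - i)) = of_nat i * f $ i * g $ (n - i) + f $ i * (of_nat (n - i) * g $ (n - i))"
    if "i \<in> {0..n}" for i
  proof -
    have "f $ i * (of_nat (n - i) * g $ (n - i)) = of_nat (n - i) * (f $ i * g $ (n - i))"
      by (metis mult.assoc mult_of_nat_commute)
    moreover have "(of_nat n :: 'a) = of_nat i + of_nat (n - i)"
      using that by (metis atLeastAtMost_iff le_add_diff_inverse of_nat_add)
    ultimately show ?thesis by (simp add: distrib_right mult.assoc)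
  qed
  then have "(\<Sum>i = 0..n. of_nat n * (f $ i * g $ (n - i))) =
      (\<Sum>i = 0..n. of_nat i * f $ i * g $ (n - i) + f $ i * (of_nat (n - i) * g $ (n - i)))"
    by (rule sum.cong[OF refl])
  then show "euler (f * g) $ n = (euler f * g + f * euler g) $ n"
    by (simp add: fps_mult_nth sum_distrib_left sum.distrib)
qed

lemma euler_add: "euler (f + g) = euler f + euler g"
  by (rule fps_ext) (simp add: algebra_simps)
lemma euler_diff: "euler (f - g) = euler f - (euler g :: 'a::ring_1 fps)"
  by (rule fps_ext) (simp add: algebra_simps)

text \<open>As \<open>a $ 0 = 0\<close>, the equation for the difference expresses n times its n-th
  coefficient by the earlier ones, and n can be cancelled. The identities for products of
  exponentials reduce to this.\<close>

lemma euler_eqI: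
  fixes a Y Z :: "'a::ring_1 fps"
  assumes tf: "\<And>n x::'a. of_nat (Suc n) * x = 0 \<Longrightarrow> x = 0"
    and "a $ 0 = 0" and Y: "euler Y = a * Y" and Z: "euler Z = a * Z" and "Y $ 0 = Z $ 0"
  shows "Y = Z"
proof -
  define D where "D = Y - Z"
  have D: "euler D = a * D" "D $ 0 = 0"
    using Y Z assms(5) by (simp_all add: D_def euler_diff right_diff_distrib)
  have "D $ n = 0" for n
  proof (induction n rule: less_induct)
    case (less n)
    show ?case
    proof (cases n)
      case 0 with D show ?thesis by simp
    next
      case (Suc k)
      have "of_nat n * D $ n = (\<Sum>i=0..n. a $ i * D $ (n - i))"
        using D(1) by (metis euler_nth fps_mult_nth)
      also have "\<dots> = 0"
      proof (rule sum.neutral, rule ballI)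
        fix i assume "i \<in> {0..n}"
        then show "a $ i * D $ (n - i) = 0"
          using less.IH[of "n - i"] assms(2) Suc by (cases i) auto
      qed
      finally show ?thesis using tf Suc by blast
    qed
  qed
  then have "D = 0" by (intro fps_ext) simp
  then show ?thesis by (simp add: D_def)
qed

subsection \<open>Exponentials of commuting series and their exchange relation\<close>

text \<open>Stronger than \<open>A * B = B * A\<close>: it says that A(z) and B(y) commute for
  independent z and y, and so it passes to \<open>euler\<close> and to exponentials.\<close>

definition coeffs_commute :: "'a::ring_1 fps \<Rightarrow> 'a fps \<Rightarrow> bool" where
  "coeffs_commute A B \<longleftrightarrow> (\<forall>i j. A $ i * B $ j = B $ j * A $ i)"

lemma coeffs_commute_mult_eq:
  assumes "coeffs_commute A B"
  shows "A * B = B * A"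
proof (rule fps_ext)
  fix n
  have "(A * B) $ n = (\<Sum>i=0..n. A $ (n - i) * B $ i)"
    unfolding fps_mult_nth by (rule sum.reindex_bij_witness[of _ "\<lambda>i. n - i" "\<lambda>i. n - i"]) auto
  also have "\<dots> = (B * A) $ n"
    using assms by (simp add: fps_mult_nth coeffs_commute_def)
  finally show "(A * B) $ n = (B * A) $ n" .
qed

lemma coeffs_commute_sym: "coeffs_commute A B \<Longrightarrow> coeffs_commute B A"
  by (simp add: coeffs_commute_def)

lemma coeffs_commute_mult:
  assumes "coeffs_commute A B" "coeffs_commute A C"
  shows "coeffs_commute A (B * C)"
proof -
  have "A $ i * (\<Sum>k=0..j. B $ k * C $ (j - k)) = (\<Sum>k=0..j. B $ k * C $ (j - k)) * A $ i" for i j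
    unfolding sum_distrib_left sum_distrib_right
    using assms by (intro sum.cong) (simp_all add: coeffs_commute_def, metis mult.assoc)
  then show ?thesis by (simp add: coeffs_commute_def fps_mult_nth)
qed

lemma coeffs_commute_power: "coeffs_commute A B \<Longrightarrow> coeffs_commute A (B ^ n)"
  by (induction n) (simp_all add: coeffs_commute_mult, simp add: coeffs_commute_def fps_one_def)

lemma coeffs_commute_euler: "coeffs_commute A B \<Longrightarrow> coeffs_commute A (euler B)"
  unfolding coeffs_commute_def euler_nth
  by (metis mult.assoc mult_of_nat_commute)

lemma coeffs_commute_uminus: "coeffs_commute A B \<Longrightarrow> coeffs_commute A (- B)"
  by (simp add: coeffs_commute_def)

lemma power_nth_eq_0:
  assumes "A $ 0 = 0" "j < n"
  shows "(A ^ n) $ j = (0::'a::ring_1)"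
  using assms(2)
proof (induction n arbitrary: j)
  case (Suc n)
  have "A $ i * (A ^ n) $ (j - i) = 0" if "i \<in> {0..j}" for i
    using that Suc assms(1) by (cases i) auto
  then show ?case by (simp add: fps_mult_nth)
qed simp

text \<open>For \<open>A $ 0 = 0\<close> the power \<open>A ^ n\<close> starts in degree n, so
  cutting the exponential series at n = j loses nothing in degree j.\<close>

definition fps_expo :: "('i, 'k::field_char_0) endo fps \<Rightarrow> ('i, 'k) endo fps" where
  "fps_expo A = Abs_fps (\<lambda>j. \<Sum>n\<le>j. scal (1 / fact n) * (A ^ n) $ j)"

lemma fps_expo_nth:
  assumes "A $ 0 = 0" "j \<le> N"
  shows "fps_expo A $ j = (\<Sum>n\<le>N. scal (1 / fact n) * (A ^ n) $ j)"
  unfolding fps_expo_def fps_nth_Abs_fps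
  by (rule sum.mono_neutral_left) (use assms power_nth_eq_0[OF assms(1)] in auto)

lemma fps_expo_0 [simp]: "fps_expo A $ 0 = 1"
  by (simp add: fps_expo_def)

lemma euler_power:
  assumes "coeffs_commute A A"
  shows "euler (A ^ Suc n) = of_nat (Suc n) * (euler A * A ^ n)"
proof (induction n)
  case 0 show ?case by simp
next
  case (Suc n)
  have c: "A * euler A = euler A * A"
    by (intro coeffs_commute_mult_eq coeffs_commute_euler assms)
  have "euler (A ^ Suc (Suc n)) = euler A * A ^ Suc n + A * euler (A ^ Suc n)"
    by (simp only: power_Suc[of A "Suc n"] euler_mult)
  also have "A * euler (A ^ Suc n) = of_nat (Suc n) * (A * euler A * A ^ n)"
    unfolding Suc by (metis mult.assoc mult_of_nat_commute)
  also have "A * euler A * A ^ n = euler A * A ^ Suc n"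
    by (simp only: c power_Suc mult.assoc)
  finally show ?case by (simp add: algebra_simps)
qed

lemma of_nat_scal_fact:
  "of_nat (Suc n) * scal (1 / fact (Suc n)) = (scal (1 / fact n) :: ('i, 'k::field_char_0) endo)"
  unfolding scal_of_nat[symmetric] scal_mult[symmetric]
  by (simp del: of_nat_Suc)

lemma euler_fps_expo:
  fixes A :: "('i, 'k::field_char_0) endo fps"
  assumes A0: "A $ 0 = 0" and "coeffs_commute A A"
  shows "euler (fps_expo A) = euler A * fps_expo A"
proof (rule fps_ext)
  fix j
  have of_nat_nth: "(of_nat k * f) $ j = of_nat k * f $ j" for k and f :: "('i, 'k) endo fps"
    by (simp add: fps_of_nat[symmetric])
  have sc: "of_nat k * (scal c * f) = scal c * (of_nat k * f)" for k c and f :: "('i, 'k) endo"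
    by (metis mult.assoc scal_commute)
  \<comment> \<open>The extra term at \<open>Suc j\<close> is there because differentiation lowers
    the summation index by one, which leaves a sum up to j.\<close>
  have "euler (fps_expo A) $ j = (\<Sum>n\<le>Suc j. scal (1 / fact n) * (euler (A ^ n)) $ j)"
    by (simp only: euler_nth fps_expo_nth[OF A0, of j "Suc j"] le_SucI order_refl sum_distrib_left sc)
  also have "\<dots> = (\<Sum>n\<le>j. scal (1 / fact (Suc n)) * (euler (A ^ Suc n)) $ j)"
    by (subst sum.atMost_Suc_shift) (simp add: fps_one_def)
  also have "\<dots> = (\<Sum>n\<le>j. scal (1 / fact n) * (euler A * A ^ n) $ j)"
    unfolding euler_power[OF assms(2)] of_nat_nth
    by (intro sum.cong refl) (metis mult.assoc of_nat_scal_fact scal_commute)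
  also have "\<dots> = (\<Sum>n\<le>j. \<Sum>i=0..j. euler A $ i * (scal (1 / fact n) * (A ^ n) $ (j - i)))"
    unfolding fps_mult_nth sum_distrib_left
    by (intro sum.cong refl) (metis mult.assoc scal_commute)
  also have "\<dots> = (\<Sum>i=0..j. euler A $ i * (\<Sum>n\<le>j. (scal (1 / fact n) * (A ^ n) $ (j - i))))"
    unfolding sum_distrib_left by (rule sum.swap)
  also have "\<dots> = (euler A * fps_expo A) $ j"
    unfolding fps_mult_nth by (intro sum.cong refl) (simp add: fps_expo_nth[OF A0, of _ j])
  finally show "euler (fps_expo A) $ j = (euler A * fps_expo A) $ j" .
qed

lemma coeffs_commute_fps_expo:
  assumes "coeffs_commute A B"
  shows "coeffs_commute A (fps_expo B)"
  unfolding coeffs_commute_def fps_expo_def fps_nth_Abs_fps sum_distrib_left sum_distrib_right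
proof (intro allI sum.cong refl)
  fix i j n
  have "A $ i * (B ^ n) $ j = (B ^ n) $ j * A $ i"
    using coeffs_commute_power[OF assms] by (simp add: coeffs_commute_def)
  then show "A $ i * (scal (1 / fact n) * (B ^ n) $ j) = scal (1 / fact n) * (B ^ n) $ j * A $ i"
    by (metis mult.assoc scal_commute)
qed

lemma fps_expo_add:
  fixes A B :: "('i, 'k::field_char_0) endo fps"
  assumes "A $ 0 = 0" "B $ 0 = 0" "coeffs_commute A A" "coeffs_commute B B" "coeffs_commute A B"
  shows "fps_expo (A + B) = fps_expo A * fps_expo B"
proof (rule euler_eqI[where a = "euler A + euler B"])
  show "of_nat (Suc n) * x = 0 \<Longrightarrow> x = 0" for n and x :: "('i, 'k) endo"
    by (rule of_nat_mult_endo_eq_0)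
  have "coeffs_commute (A + B) (A + B)"
    using assms by (auto simp: coeffs_commute_def algebra_simps)
  then show "euler (fps_expo (A + B)) = (euler A + euler B) * fps_expo (A + B)"
    using assms by (simp add: euler_fps_expo euler_add)
  have "fps_expo A * euler B = euler B * fps_expo A"
    by (intro coeffs_commute_mult_eq coeffs_commute_euler coeffs_commute_sym[OF coeffs_commute_fps_expo]
      coeffs_commute_sym[OF assms(5)])
  then show "euler (fps_expo A * fps_expo B) = (euler A + euler B) * (fps_expo A * fps_expo B)"
    using assms by (simp add: euler_mult euler_fps_expo distrib_right mult.assoc) (simp flip: mult.assoc)
qed (simp_all add: euler_def)

section \<open>The substitution of -z for z, and odd series\<close>

definition fps_alt :: "'a::ring_1 fps \<Rightarrow> 'a fps" where
  "fps_alt f = Abs_fps (\<lambda>n. (- 1) ^ n * f $ n)"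

lemma fps_alt_nth: "fps_alt f $ n = (- 1) ^ n * f $ n"
  by (simp add: fps_alt_def)

lemma minus_one_power_commute: "(- 1) ^ n * x = x * (- 1 :: 'a::ring_1) ^ n"
  by (cases "even n") auto

lemma fps_alt_mult: "fps_alt (f * g) = fps_alt f * fps_alt g"
proof (rule fps_ext)
  fix n
  have "(- 1) ^ n * (f $ i * g $ (n - i)) = (- 1) ^ i * f $ i * ((- 1) ^ (n - i) * g $ (n - i))"
    if "i \<in> {0..n}" for i
  proof -
    have "(- 1 :: 'a) ^ n = (- 1) ^ i * (- 1) ^ (n - i)"
      using that by (simp flip: power_add)
    then have "(- 1) ^ n * (f $ i * g $ (n - i)) = (- 1) ^ i * ((- 1) ^ (n - i) * f $ i) * g $ (n - i)"
      by (simp add: mult.assoc)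
    then show ?thesis by (simp only: mult.assoc minus_one_power_commute[of "n - i" "f $ i"])
  qed
  then show "fps_alt (f * g) $ n = (fps_alt f * fps_alt g) $ n"
    by (simp add: fps_alt_nth fps_mult_nth sum_distrib_left)
qed

lemma fps_alt_power: "fps_alt (A ^ n) = fps_alt A ^ n"
proof (induction n)
  case 0 show ?case by (rule fps_ext) (simp add: fps_alt_nth)
qed (simp add: fps_alt_mult)

lemma fps_alt_fps_expo: "fps_alt (fps_expo A) = fps_expo (fps_alt A)"
proof (rule fps_ext)
  fix n
  have "(- 1) ^ n * (scal (1 / fact i) * (A ^ i) $ n) = scal (1 / fact i) * ((- 1) ^ n * (A ^ i) $ n)" for i
    by (cases "even n") simp_all
  then show "fps_alt (fps_expo A) $ n = fps_expo (fps_alt A) $ n"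
    by (simp add: fps_alt_nth fps_expo_def sum_distrib_left flip: fps_alt_power)
qed

lemma fps_alt_euler: "fps_alt (euler A) = euler (fps_alt A)"
  by (rule fps_ext) (simp add: fps_alt_nth, metis mult.assoc minus_one_power_commute)

definition odd_fps :: "'a::ring_1 fps \<Rightarrow> bool" where
  "odd_fps A \<longleftrightarrow> (\<forall>n. even n \<longrightarrow> A $ n = 0)"

lemma odd_fps_0: "odd_fps A \<Longrightarrow> A $ 0 = 0"
  by (simp add: odd_fps_def)

lemma fps_alt_odd: "odd_fps A \<Longrightarrow> fps_alt A = - A"
  by (rule fps_ext) (auto simp: fps_alt_nth odd_fps_def minus_one_power_iff)

lemma fps_alt_expo_mult:
  fixes A :: "('i, 'k::field_char_0) endo fps"
  assumes "odd_fps A" "coeffs_commute A A"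
  shows "fps_alt (fps_expo A) * fps_expo A = 1"
proof -
  have "fps_expo (- A + A) = fps_expo (- A) * fps_expo A"
    using assms odd_fps_0[OF assms(1)]
    by (intro fps_expo_add) (auto simp: coeffs_commute_def)
  moreover have "fps_expo (- A + A) = 1"
  proof -
    have "(\<Sum>n\<le>j. scal (1 / fact n) * ((0::('i,'k) endo fps) ^ n) $ j) = (if j = 0 then 1 else 0)" for j
      by (cases j) (simp_all add: power_0_left if_distrib[of "\<lambda>x. _ * x $ _"] sum.delta cong: if_cong)
    then show ?thesis by (simp add: fps_expo_def fps_eq_iff)
  qed
  ultimately show ?thesis using assms(1) by (simp add: fps_alt_fps_expo fps_alt_odd)
qed

lemma odd_fps_euler: "odd_fps A \<Longrightarrow> odd_fps (euler A)"
  by (simp add: odd_fps_def)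

text \<open>For odd A the series M(-z) is the inverse of M(z), so only logarithmic derivatives
  remain. These are the derivatives of :X(-z) X(y): on the diagonal, from which the quadratic
  operator arises.\<close>

lemma fps_alt_expo_euler:
  fixes A :: "('i, 'k::field_char_0) endo fps"
  assumes odd: "odd_fps A" and comm: "coeffs_commute A A"
  defines "M \<equiv> fps_expo A" and "M' \<equiv> fps_alt (fps_expo A)"
  shows "M' * euler M = euler A" "euler M' * M = - euler A"
    "euler M' * euler M = - (euler A * euler A)"
proof -
  have e: "euler M = euler A * M"
    using odd_fps_0[OF odd] comm by (simp add: M_def euler_fps_expo)
  have e': "euler M' = - euler A * M'"
    unfolding M'_def M_def[symmetric] fps_alt_euler[symmetric] e fps_alt_mult
    using odd_fps_euler[OF odd] by (simp add: fps_alt_odd)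
  have c1: "M' * euler A = euler A * M'"
  proof -
    have "M' = fps_expo (- A)" using odd by (simp add: M'_def fps_alt_fps_expo fps_alt_odd)
    then show ?thesis
      by (simp add: coeffs_commute_mult_eq coeffs_commute_euler coeffs_commute_sym comm
          coeffs_commute_sym[OF coeffs_commute_fps_expo] coeffs_commute_uminus)
  qed
  have 1: "M' * M = 1" unfolding M_def M'_def by (rule fps_alt_expo_mult[OF odd comm])
  show "M' * euler M = euler A"
    by (metis e c1 1 mult.assoc mult.right_neutral)
  show "euler M' * M = - euler A"
    by (metis e' 1 mult.assoc mult.right_neutral)
  show "euler M' * euler M = - (euler A * euler A)"
    by (metis e' \<open>M' * euler M = euler A\<close> mult.assoc mult_minus_left)
qed

text \<open>The factor \<open>(z - w)/(z + w)\<close> of the operator product, expanded in \<open>w/z\<close>.\<close>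

definition cross_coeff :: "nat \<Rightarrow> int" where
  "cross_coeff n = (if n = 0 then 1 else 2 * (- 1) ^ n)"

text \<open>Logarithmic derivative: t d/dt log((1 - t)/(1 + t)) = -2 (t + t^3 + ...).\<close>

lemma cross_coeff_rec:
  "int n * cross_coeff n = (\<Sum>j=0..n. (if odd j then - 2 else 0) * cross_coeff (n - j))"
proof -
  define S where "S n = (\<Sum>i=0..n. if odd (n + i) then cross_coeff i else 0)" for n :: nat
  have step: "S (Suc (Suc n)) = S n + cross_coeff (Suc n)" for n
    by (simp add: S_def)
  have S: "S n = - (int n * (- 1) ^ n)" for n
  proof (induction n rule: induct_nat_012)
    case (ge2 n) then show ?case by (simp add: step cross_coeff_def algebra_simps)
  qed (simp_all add: S_def cross_coeff_def)
  have "(\<Sum>j=0..n. (if odd j then - 2 else 0) * cross_coeff (n - j)) = - 2 * S n"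
    unfolding S_def sum_distrib_left
    by (rule sum.reindex_bij_witness[of _ "\<lambda>i. n - i" "\<lambda>i. n - i"]) (auto simp: even_diff_nat)
  then show ?thesis by (simp add: S cross_coeff_def)
qed

text \<open>The commutator of i \<open>A $ i\<close> with B(y) is central, namely -2 y^i for odd i
  and 0 otherwise; hence commuting with exp B(y) multiplies by it. The error \<open>Y\<close> solves
  the Euler equation in y with zero constant term.\<close>

lemma fps_const_annihilator_expo:
  fixes A B :: "('i, 'k::field_char_0) endo fps"
  assumes "odd_fps B" "coeffs_commute B B"
    and comm: "\<And>i j. of_nat i * (A $ i * B $ j - B $ j * A $ i) = (if i = j \<and> odd i then - 2 else 0)"
  shows "fps_const (euler A $ i) * fps_expo B
     = fps_expo B * fps_const (euler A $ i) + (if odd i then - 2 else 0) * fps_X ^ i * fps_expo B"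
proof -
  define a where "a = fps_const (euler A $ i)"
  define c :: "('i, 'k) endo" where "c = (if odd i then - 2 else 0)"
  define M where "M = fps_expo B"
  define Z where "Z = fps_const c * fps_X ^ i"
  define Y where "Y = a * M - M * a - Z * M"
  have eM: "euler M = euler B * M"
    using assms(2) odd_fps_0[OF assms(1)] by (simp add: M_def euler_fps_expo)
  have ea: "euler a = 0" by (rule fps_ext) (simp add: a_def)
  have ccomm: "c * x = x * c" for x
  proof -
    have "c = of_int (if odd i then - 2 else 0)" by (simp add: c_def)
    then show ?thesis by (metis mult_of_int_commute)
  qed
  have cX: "Z * f = f * Z" for f
  proof -
    have "fps_const c * f = f * fps_const c" by (rule fps_ext) (simp add: ccomm)
    then show ?thesis unfolding Z_def by (metis mult.assoc fps_mult_fps_X_power_commute)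
  qed
  have eX: "euler Z = of_nat i * Z"
    by (rule fps_ext) (simp add: Z_def fps_X_power_iff fps_of_nat[symmetric])
  have aB: "a * euler B = euler B * a + of_nat i * Z"
  proof (rule fps_ext)
    fix j
    have "of_nat i * A $ i * (of_nat j * B $ j) = of_nat j * B $ j * (of_nat i * A $ i)
        + of_nat j * (of_nat i * (A $ i * B $ j - B $ j * A $ i))"
    proof -
      have "of_nat i * A $ i * (of_nat j * B $ j) = of_nat j * (of_nat i * (A $ i * B $ j))"
        by (metis mult.assoc mult_of_nat_commute)
      moreover have "of_nat j * B $ j * (of_nat i * A $ i) = of_nat j * (of_nat i * (B $ j * A $ i))"
        by (metis mult.assoc mult_of_nat_commute)
      ultimately show ?thesis by (simp add: right_diff_distrib)
    qed
    then show "(a * euler B) $ j = (euler B * a + of_nat i * Z) $ j"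
      by (simp add: Z_def a_def comm c_def fps_X_power_iff fps_of_nat[symmetric])
  qed
  have "Y = 0"
  proof (rule euler_eqI[where a = "euler B"])
    show "of_nat (Suc n) * x = 0 \<Longrightarrow> x = 0" for n and x :: "('i, 'k) endo"
      by (rule of_nat_mult_endo_eq_0)
    have "euler Y = a * euler B * M - euler B * M * a - of_nat i * Z * M
        - Z * euler B * M"
      by (simp add: Y_def euler_diff euler_mult ea eM eX mult.assoc distrib_left)
    also have "\<dots> = euler B * Y"
    proof -
      have "a * euler B * M = euler B * a * M + of_nat i * Z * M" by (simp add: aB distrib_right)
      moreover have "Z * euler B * M = euler B * Z * M" by (simp only: cX)
      ultimately show ?thesis by (simp add: Y_def right_diff_distrib mult.assoc)
    qed
    finally show "euler Y = euler B * Y" .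
    show "Y $ 0 = 0 $ 0"
      by (cases i) (auto simp: Z_def Y_def a_def M_def c_def)
  qed (simp_all add: euler_def fps_eq_iff)
  moreover have "fps_const c = (if odd i then - 2 else 0)"
    by (auto simp: c_def numeral_fps_const)
  ultimately show ?thesis
    by (simp add: Z_def Y_def M_def a_def algebra_simps)
qed

lemma of_int_rearrange:
  "of_int a * x * (of_int b * y) = of_int (a * b) * (x * y :: 'a::ring_1)"
  unfolding of_int_mult by (metis mult.assoc mult_of_int_commute)

text \<open>With t = y/z, the commutator of A(z) and B(y) is the central series -2 (t + t^3/3 + ...)
  = log((1 - t)/(1 + t)). So moving E(z) past M(y) costs (1 - t)/(1 + t); with the denominator
  cleared, (1 + t) E(z) M(y) = (1 - t) M(y) E(z) has coefficients with two terms on each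
  side.\<close>

lemma expo_exchange:
  fixes A B :: "('i, 'k::field_char_0) endo fps"
  assumes A: "odd_fps A" "coeffs_commute A A" and B: "odd_fps B" "coeffs_commute B B"
    and comm: "\<And>i j. of_nat i * (A $ i * B $ j - B $ j * A $ i) = (if i = j \<and> odd i then - 2 else 0)"
  defines "E \<equiv> fps_expo A" and "M \<equiv> fps_expo B"
  shows "E $ Suc b * M $ Suc a + E $ b * M $ a = M $ Suc a * E $ Suc b - M $ a * E $ b"
    and "E $ Suc b * M $ 0 = M $ 0 * E $ Suc b"
    and "E $ 0 * M $ Suc a = M $ Suc a * E $ 0"
proof -
  \<comment> \<open>Series in two variables, the outer one being 1/z and the inner one y:
    \<open>EE\<close> is E(z), \<open>fps_const M\<close> is M(y), \<open>p\<close> is t, and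
    \<open>r\<close> will turn out to be (1 - t)/(1 + t).\<close>
  define EE where "EE = Abs_fps (\<lambda>b. fps_const (E $ b))"
  define AA where "AA = Abs_fps (\<lambda>b. fps_const (euler A $ b))"
  define s :: "('i, 'k) endo fps fps" where
    "s = Abs_fps (\<lambda>j. of_int (if odd j then - 2 else 0) * fps_X ^ j)"
  define r :: "('i, 'k) endo fps fps" where "r = Abs_fps (\<lambda>j. of_int (cross_coeff j) * fps_X ^ j)"
  define p :: "('i, 'k) endo fps fps" where "p = fps_const fps_X * fps_X"
  have central: "(of_int k * fps_X ^ j) * f = f * (of_int k * fps_X ^ j)" for k j and f :: "('i, 'k) endo fps"
    by (metis mult.assoc mult_of_int_commute fps_mult_fps_X_power_commute)
  have fc: "s * f = f * s" "r * f = f * r" for f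
    by (intro coeffs_commute_mult_eq; simp add: coeffs_commute_def s_def r_def central)+
  have er: "euler r = s * r"
  proof (rule fps_ext)
    fix n
    have "of_int (if odd j then - 2 else 0) * fps_X ^ j * (of_int (cross_coeff (n - j)) * fps_X ^ (n - j))
        = of_int ((if odd j then - 2 else 0) * cross_coeff (n - j)) * (fps_X ^ n :: ('i, 'k) endo fps)"
      if "j \<in> {0..n}" for j
    proof -
      have "fps_X ^ n = fps_X ^ j * (fps_X ^ (n - j) :: ('i, 'k) endo fps)"
        using that by (simp flip: power_add)
      then show ?thesis
        by (simp only: of_int_rearrange)
    qed
    then have "(s * r) $ n = (\<Sum>j=0..n. of_int ((if odd j then - 2 else 0) * cross_coeff (n - j)) * fps_X ^ n)"
      by (simp only: fps_mult_nth s_def r_def fps_nth_Abs_fps cong: sum.cong)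
    also have "\<dots> = of_int (int n * cross_coeff n) * fps_X ^ n"
      unfolding cross_coeff_rec of_int_sum sum_distrib_right ..
    finally show "euler r $ n = (s * r) $ n"
      by (simp add: r_def mult.assoc)
  qed
  have "euler E = euler A * E"
    using A(2) odd_fps_0[OF A(1)] by (simp add: E_def euler_fps_expo)
  then have E_rec: "of_nat b * E $ b = (\<Sum>j=0..b. euler A $ j * E $ (b - j))" for b
    by (metis euler_nth fps_mult_nth)
  have eE: "euler EE = AA * EE"
  proof (rule fps_ext)
    fix b
    have "of_nat b * fps_const (E $ b) = (\<Sum>j=0..b. fps_const (euler A $ j * E $ (b - j)))"
      unfolding fps_of_nat[symmetric] fps_const_mult[symmetric]
      by (rule fps_ext) (simp add: E_rec fps_sum_nth del: euler_nth)
    moreover have "euler EE $ b = of_nat b * fps_const (E $ b)"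
      by (simp add: EE_def)
    ultimately show "euler EE $ b = (AA * EE) $ b"
      by (simp add: EE_def AA_def fps_mult_nth del: euler_nth)
  qed
  have aM: "AA * fps_const M = fps_const M * (AA + s)"
  proof (rule fps_ext)
    fix j
    have "(if odd j then - 2 else 0) * fps_X ^ j * M = M * (of_int (if odd j then - 2 else 0) * fps_X ^ j)"
      unfolding central[symmetric] by simp
    then show "(AA * fps_const M) $ j = (fps_const M * (AA + s)) $ j"
      using fps_const_annihilator_expo[OF B comm, of j]
      by (simp add: AA_def s_def M_def distrib_left del: euler_nth)
  qed
  \<comment> \<open>In the variable 1/z both sides solve the Euler equation with coefficient
    \<open>AA\<close>: moving \<open>AA\<close> past M(y) produces \<open>s\<close>, the logarithmic
    derivative of \<open>r\<close>.\<close>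
  have main: "EE * fps_const M = fps_const M * EE * r"
  proof (rule euler_eqI[where a = AA])
    show "x = 0" if "of_nat (Suc n) * x = 0" for n and x :: "('i, 'k) endo fps"
    proof (rule fps_ext)
      fix i
      have "of_nat (Suc n) * x $ i = 0"
        using arg_cong[OF that, of "\<lambda>f. f $ i"] by (simp add: fps_of_nat[symmetric] del: of_nat_Suc)
      then show "x $ i = 0 $ i" using of_nat_mult_endo_eq_0 by simp
    qed
    have eM: "euler (fps_const M) = 0" by (rule fps_ext) simp
    show "euler (EE * fps_const M) = AA * (EE * fps_const M)"
      by (simp add: euler_mult eE eM mult.assoc)
    have "euler (fps_const M * EE * r) = fps_const M * AA * EE * r + fps_const M * EE * (s * r)"
      by (simp add: euler_mult eE eM er mult.assoc distrib_left)
    also have "fps_const M * EE * (s * r) = fps_const M * s * EE * r"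
      by (metis fc(1) mult.assoc)
    finally show "euler (fps_const M * EE * r) = AA * (fps_const M * EE * r)"
      by (simp add: aM distrib_left distrib_right flip: mult.assoc)
  qed (simp_all add: AA_def EE_def E_def r_def cross_coeff_def)
  have "r * (1 + p) = 1 - p"
  proof (rule fps_ext)
    fix n
    have "r $ Suc m + r $ m * fps_X = (if m = 0 then - fps_X else 0)" for m
    proof (cases m)
      case 0
      have "fps_X - 2 * fps_X = (- fps_X :: ('i, 'k) endo fps)" by (simp only: mult_2) simp
      with 0 show ?thesis by (simp add: r_def cross_coeff_def)
    next
      case (Suc k)
      then show ?thesis
        by (simp add: r_def cross_coeff_def mult.assoc power_commutes)
    qed
    then show "(r * (1 + p)) $ n = (1 - p) $ n"
      by (cases n) (auto simp: p_def distrib_left r_def cross_coeff_def simp flip: mult.assoc)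
  qed
  with main have *: "EE * fps_const M * (1 + p) = fps_const M * EE * (1 - p)"
    by (metis mult.assoc)
  have **: "fps_const (E $ Suc b) * M + fps_const (E $ b) * M * fps_X
      = M * fps_const (E $ Suc b) - M * fps_const (E $ b) * fps_X"
    using arg_cong[OF *, of "\<lambda>f. f $ Suc b"]
    by (simp add: p_def EE_def distrib_left right_diff_distrib flip: mult.assoc)
  show "E $ Suc b * M $ Suc a + E $ b * M $ a = M $ Suc a * E $ Suc b - M $ a * E $ b"
    using arg_cong[OF **, of "\<lambda>f. f $ Suc a"] by simp
  show "E $ Suc b * M $ 0 = M $ 0 * E $ Suc b"
    using arg_cong[OF **, of "\<lambda>f. f $ 0"] by simp
  show "E $ 0 * M $ Suc a = M $ Suc a * E $ 0"
    by (simp add: E_def)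
qed

subsection \<open>Gradings\<close>

text \<open>Extension by zero to negative indices makes the exchange relation and shifts of
  summation uniform at the boundary.\<close>

definition int_nth :: "'a::zero fps \<Rightarrow> int \<Rightarrow> 'a" (infixl "$%" 75) where
  "f $% n = (if n < 0 then 0 else f $ nat n)"

lemma int_nth_neg [simp]: "n < 0 \<Longrightarrow> f $% n = 0"
  by (simp add: int_nth_def)

lemma int_nth_int [simp]: "f $% int n = f $ n"
  by (simp add: int_nth_def)

lemma int_nth_mult: "(f * g) $% n = (\<Sum>i\<in>{0..n}. f $% i * g $% (n - i))"
proof (cases "n < 0")
  case False
  then obtain k where "n = int k" by (metis not_less nonneg_int_cases)
  show ?thesis
    unfolding \<open>n = int k\<close> int_nth_int fps_mult_nth
    by (intro sum.reindex_bij_witness[of _ nat int]) (auto simp: int_nth_def nat_diff_distrib)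
qed simp

lemma int_nth_mult_superset:
  fixes f g :: "'a::semiring_1 fps"
  assumes "l \<le> 0" "n \<le> N"
  shows "(f * g) $% n = (\<Sum>i\<in>{l..N}. f $% i * g $% (n - i))"
  unfolding int_nth_mult by (rule sum.mono_neutral_left) (use assms in auto)

lemma int_nth_fps_alt: "fps_alt f $% n = (if even n then f $% n else - (f $% n))"
  by (auto simp: int_nth_def fps_alt_nth even_nat_iff)

lemma int_nth_euler: "euler f $% n = of_int n * f $% n"
  by (auto simp: int_nth_def)

lemma int_nth_1: "1 $% n = (if n = 0 then 1 else 0)"
  by (auto simp: int_nth_def)

lemma int_nth_uminus: "(- f) $% n = - (f $% n :: 'a::ring_1)"
  by (auto simp: int_nth_def)

lemma expo_exchange_int:
  fixes A B :: "('i, 'k::field_char_0) endo fps"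
  assumes A: "odd_fps A" "coeffs_commute A A" and B: "odd_fps B" "coeffs_commute B B"
    and comm: "\<And>i j. of_nat i * (A $ i * B $ j - B $ j * A $ i) = (if i = j \<and> odd i then - 2 else 0)"
  defines "E \<equiv> fps_expo A" and "M \<equiv> fps_expo B"
  shows "E $% (b + 1) * M $% a + E $% b * M $% (a - 1) = M $% a * E $% (b + 1) - M $% (a - 1) * E $% b"
proof -
  note ex = expo_exchange[OF assms(1-5), folded E_def M_def]
  consider "a < 0 \<or> b + 1 < 0" | "a \<ge> 0" "b + 1 = 0" | "a = 0" "b \<ge> 0" | "a > 0" "b \<ge> 0" by linarith
  then show ?thesis
  proof cases
    case 2
    then show ?thesis by (simp add: int_nth_def E_def)
  next
    case 3
    then obtain k where "b = int k" using nonneg_int_cases by blast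
    then show ?thesis using 3 ex(2)[of k] by (simp add: int_nth_def nat_add_distrib)
  next
    case 4
    then obtain k l where "b = int k" "a = int (Suc l)"
      using nonneg_int_cases pos_int_cases by (metis Suc_pred')
    then show ?thesis using ex(1)[of k l] by (simp add: int_nth_def nat_add_distrib)
  qed auto
qed

section \<open>Homogeneous operators and the finite sums they give\<close>

locale weight =
  fixes wt :: "'i \<Rightarrow> nat"
begin

text \<open>\<open>T\<close> lowers the weight by \<open>d\<close>.\<close>

definition homog :: "int \<Rightarrow> ('i, 'k::field_char_0) endo \<Rightarrow> bool" where
  "homog d T \<longleftrightarrow> (\<forall>G i. (\<forall>j. int (wt j) = int (wt i) + d \<longrightarrow> G j = 0) \<longrightarrow> app T G i = 0)"

lemma homogD: "homog d T \<Longrightarrow> (\<And>j. int (wt j) = int (wt i) + d \<Longrightarrow> G j = 0) \<Longrightarrow> app T G i = 0"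
  unfolding homog_def by blast

lemma homog_neg: "homog d T \<Longrightarrow> int (wt i) + d < 0 \<Longrightarrow> app T G i = 0"
  by (rule homogD) auto

lemma homog_cong:
  assumes "homog d T" "\<And>j. int (wt j) = int (wt i) + d \<Longrightarrow> G j = H j"
  shows "app T G i = app T H i"
  using homogD[OF assms(1), of i "\<lambda>j. G j - H j"] assms(2) by (simp add: app_arg_diff)

lemma homog_mult: "homog d S \<Longrightarrow> homog e T \<Longrightarrow> homog (d + e) (S * T)"
  by (auto simp: homog_def app_mult)

lemma homog_0: "homog d 0" and homog_1: "homog 0 1"
  by (auto simp: homog_def)

lemma homog_add: "homog d S \<Longrightarrow> homog d T \<Longrightarrow> homog d (S + T)"
  by (auto simp: homog_def app_add)

lemma homog_uminus: "homog d S \<Longrightarrow> homog d (- S)"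
  by (auto simp: homog_def app_uminus)

lemma homog_sum: "(\<And>x. x \<in> A \<Longrightarrow> homog d (T x)) \<Longrightarrow> homog d (sum T A)"
  by (induction A rule: infinite_finite_induct) (auto simp: homog_0 homog_add)

lemma homog_scal: "homog 0 (scal c)"
  by (auto simp: homog_def app_scal)

text \<open>The source of finiteness is s = -1, the case of multiplications: at a given monomial
  only coefficients of index at most its weight contribute.\<close>

definition graded :: "int \<Rightarrow> ('i, 'k::field_char_0) endo fps \<Rightarrow> bool" where
  "graded s f \<longleftrightarrow> (\<forall>n. homog (s * int n) (f $ n))"

lemma graded_int: "graded s f \<Longrightarrow> homog (s * n) (f $% n)"
  by (auto simp: graded_def int_nth_def homog_0) (metis int_nat_eq not_less)

lemma graded_mult: "graded s f \<Longrightarrow> graded s g \<Longrightarrow> graded s (f * g)"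
  unfolding graded_def fps_mult_nth
proof (intro allI homog_sum)
  fix n k :: nat assume *: "\<forall>n. homog (s * int n) (f $ n)" "\<forall>n. homog (s * int n) (g $ n)" "k \<in> {0..n}"
  have "homog (s * int k + s * int (n - k)) (f $ k * g $ (n - k))"
    using * by (intro homog_mult) blast+
  moreover have "s * int k + s * int (n - k) = s * int n"
    using *(3) by (simp add: of_nat_diff algebra_simps)
  ultimately show "homog (s * int n) (f $ k * g $ (n - k))" by simp
qed

lemma graded_1: "graded s 1"
  by (auto simp: graded_def homog_0 homog_1 fps_one_nth)

lemma graded_power: "graded s f \<Longrightarrow> graded s (f ^ n)"
  by (induction n) (auto simp: graded_1 graded_mult)

lemma graded_euler: "graded s f \<Longrightarrow> graded s (euler f)"
  unfolding graded_def euler_nth scal_of_nat[symmetric]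
  using homog_mult[OF homog_scal] by fastforce

lemma graded_alt: "graded s f \<Longrightarrow> graded s (fps_alt f)"
  by (auto simp: graded_def fps_alt_nth minus_one_power_iff homog_uminus)

lemma graded_expo: "graded s f \<Longrightarrow> graded s (fps_expo f)"
  unfolding graded_def fps_expo_def fps_nth_Abs_fps
proof (intro allI homog_sum)
  fix n k :: nat assume "\<forall>n. homog (s * int n) (f $ n)"
  then have "graded s (f ^ k)" by (intro graded_power) (simp add: graded_def)
  then have "homog (0 + s * int n) (scal (1 / fact k) * (f ^ k) $ n)"
    by (intro homog_mult homog_scal) (simp add: graded_def)
  then show "homog (s * int n) (scal (1 / fact k) * (f ^ k) $ n)" by simp
qed

text \<open>By weight, terms with a + b > W vanish at m, so the square of summation can be cut to
  the triangle a + b \<le> W and regrouped by c = a + b.\<close>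

lemma conv_sum:
  fixes f1 f2 :: "('i, 'k::field_char_0) endo fps"
  assumes "graded (- 1) f1" "graded (- 1) f2" and W: "int (wt m) \<le> W"
  shows "(\<Sum>a\<in>{0..W}. \<Sum>b\<in>{0..W}. app (f1 $% a * f2 $% b) (H (a + b)) m)
       = (\<Sum>c\<in>{0..W}. app ((f1 * f2) $% c) (H c) m)"
proof -
  define h where "h a b = app (f1 $% a * f2 $% b) (H (a + b)) m" for a b
  have 0: "h a b = 0" if "a + b > W" for a b
  proof -
    have "homog (- a + - b) (f1 $% a * f2 $% b)"
      using graded_int[OF assms(1), of a] graded_int[OF assms(2), of b] by (intro homog_mult) auto
    then show ?thesis unfolding h_def by (rule homog_neg) (use that W in auto)
  qed
  have "(\<Sum>a\<in>{0..W}. \<Sum>b\<in>{0..W}. h a b) = (\<Sum>(a, b)\<in>{0..W} \<times> {0..W}. h a b)"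
    by (simp add: sum.cartesian_product)
  also have "\<dots> = (\<Sum>(a, b)\<in>{x\<in>{0..W} \<times> {0..W}. fst x + snd x \<le> W}. h a b)"
    by (intro sum.mono_neutral_right) (auto, metis 0 not_le)
  also have "\<dots> = (\<Sum>(c, a)\<in>(SIGMA c:{0..W}. {0..c}). h a (c - a))"
    by (rule sum.reindex_bij_witness[of _ "\<lambda>(c, a). (a, c - a)" "\<lambda>(a, b). (a + b, a)"]) auto
  also have "\<dots> = (\<Sum>c\<in>{0..W}. \<Sum>a\<in>{0..c}. h a (c - a))"
    by (simp add: sum.Sigma)
  also have "\<dots> = (\<Sum>c\<in>{0..W}. app ((f1 * f2) $% c) (H c) m)"
    by (simp add: h_def int_nth_mult app_sum)
  finally show ?thesis by (simp add: h_def)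
qed

text \<open>The coefficient of z^(-T) in f(z) g(z), applied to G, where f is a series in z and g one
  in 1/z. The bound on c loses nothing if \<open>graded (- 1) f\<close>.\<close>

definition bracket :: "('i, 'k::field_char_0) endo fps \<Rightarrow> ('i, 'k) endo fps \<Rightarrow> int \<Rightarrow> ('i \<Rightarrow> 'k) \<Rightarrow> 'i \<Rightarrow> 'k" where
  "bracket f g T G m = (\<Sum>c\<in>{0..int (wt m)}. app (f $% c * g $% (c + T)) G m)"

lemma bracket_superset:
  assumes "graded (- 1) f" "int (wt m) \<le> W"
  shows "bracket f g T G m = (\<Sum>c\<in>{0..W}. app (f $% c * g $% (c + T)) G m)"
  unfolding bracket_def
proof (rule sum.mono_neutral_left)
  have "app (f $% c) H m = 0" if "c > int (wt m)" for c H
    by (rule homog_neg[OF graded_int[OF assms(1)]]) (use that in auto)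
  then show "\<forall>i\<in>{0..W} - {0..int (wt m)}. app (f $% i * g $% (i + T)) G m = 0"
    by (auto simp: app_mult)
qed (use assms in auto)

text \<open>This is the restriction to z = y: the coefficients of z^(-p) y^(-q) with p + q = T are
  added. Outside -W \<le> p \<le> T + W one of the indices a + p and b + (T - p) is
  negative.\<close>

lemma bracket_diagonal:
  fixes f1 f2 g1 g2 :: "('i, 'k::field_char_0) endo fps"
  assumes "graded (- 1) f1" "graded (- 1) f2" and W: "int (wt m) \<le> W"
  shows "(\<Sum>p\<in>{- W..T + W}. \<Sum>a\<in>{0..W}. \<Sum>b\<in>{0..W}.
            app (f1 $% a * f2 $% b * (g1 $% (a + p) * g2 $% (b + (T - p)))) G m)
       = bracket (f1 * f2) (g1 * g2) T G m"
proof -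
  have in_p: "(\<Sum>p\<in>{- W..T + W}. g1 $% (a + p) * g2 $% (b + (T - p))) = (g1 * g2) $% (a + b + T)"
    if "a \<in> {0..W}" "b \<in> {0..W}" for a b
  proof -
    have "(g1 * g2) $% (a + b + T) = (\<Sum>i\<in>{a - W..a + T + W}. g1 $% i * g2 $% (a + b + T - i))"
      by (rule int_nth_mult_superset) (use that in auto)
    also have "\<dots> = (\<Sum>p\<in>{- W..T + W}. g1 $% (a + p) * g2 $% (b + (T - p)))"
      by (rule sum.reindex_bij_witness[of _ "\<lambda>p. a + p" "\<lambda>i. i - a"]) (auto simp: algebra_simps)
    finally show ?thesis ..
  qed
  have "(\<Sum>p\<in>{- W..T + W}. \<Sum>a\<in>{0..W}. \<Sum>b\<in>{0..W}.
            app (f1 $% a * f2 $% b * (g1 $% (a + p) * g2 $% (b + (T - p)))) G m)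
      = (\<Sum>a\<in>{0..W}. \<Sum>b\<in>{0..W}. \<Sum>p\<in>{- W..T + W}.
            app (f1 $% a * f2 $% b * (g1 $% (a + p) * g2 $% (b + (T - p)))) G m)"
    by (subst sum.swap) (intro sum.cong refl sum.swap)
  also have "\<dots> = (\<Sum>a\<in>{0..W}. \<Sum>b\<in>{0..W}. app (f1 $% a * f2 $% b) (app ((g1 * g2) $% (a + b + T)) G) m)"
    by (intro sum.cong refl) (simp add: app_sum[symmetric] sum_distrib_left[symmetric] in_p app_mult[symmetric])
  also have "\<dots> = (\<Sum>c\<in>{0..W}. app ((f1 * f2) $% c) (app ((g1 * g2) $% (c + T)) G) m)"
    by (rule conv_sum[OF assms, where H = "\<lambda>c. app ((g1 * g2) $% (c + T)) G"])
  finally show ?thesis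
    by (simp add: bracket_superset[OF graded_mult[OF assms(1,2)] W] app_mult)
qed

end

subsection \<open>The bilinear identity in a Heisenberg representation\<close>

lemma sum_int_shift:
  fixes h :: "int \<Rightarrow> 'a::comm_monoid_add"
  assumes "h 0 = 0" "h (U + 1) = 0" "0 \<le> U"
  shows "(\<Sum>b\<in>{0..U}. h (b + 1)) = (\<Sum>b\<in>{0..U}. h b)"
proof -
  have "(\<Sum>b\<in>{0..U}. h (b + 1)) = (\<Sum>b\<in>{1..U + 1}. h b)"
    by (rule sum.reindex_bij_witness[of _ "\<lambda>b. b - 1" "\<lambda>b. b + 1"]) auto
  also have "\<dots> = (\<Sum>b\<in>{0..U + 1}. h b)"
    by (rule sum.mono_neutral_left) (use assms in \<open>auto, metis antisym_conv linorder_not_le zle_add1_eq_le add_0\<close>)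
  also have "\<dots> = (\<Sum>b\<in>{0..U}. h b)"
    by (rule sum.mono_neutral_right) (use assms in \<open>auto, metis antisym_conv not_le zless_imp_add1_zle\<close>)
  finally show ?thesis .
qed

lemma of_int_eq_scal: "of_int k = scal (of_int k)"
  by (cases k) (auto simp: scal_of_nat scal_uminus simp flip: of_nat_Suc simp del: of_nat_Suc)

lemma app_of_int: "app (of_int k * T) F i = of_int k * app T F i"
  by (simp add: of_int_eq_scal app_mult app_scal)

lemma app_of_int4:
  "app (of_int k1 * x1 * (of_int k2 * x2) * (of_int k3 * x3 * (of_int k4 * x4))) F i
     = of_int (k1 * k2 * k3 * k4) * app (x1 * x2 * (x3 * x4)) F i"
proof -
  have "of_int k1 * x1 * (of_int k2 * x2) * (of_int k3 * x3 * (of_int k4 * x4))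
      = of_int (k1 * k2 * (k3 * k4)) * (x1 * x2 * (x3 * x4))"
    by (simp only: of_int_rearrange)
  then show ?thesis by (simp only: app_of_int mult.assoc)
qed

locale heisenberg = weight wt for wt :: "'i \<Rightarrow> nat" +
  fixes A B :: "('i, 'k::field_char_0) endo fps"
  assumes A: "odd_fps A" "coeffs_commute A A" "graded 1 A"
    and B: "odd_fps B" "coeffs_commute B B" "graded (- 1) B"
    and comm: "\<And>i j. of_nat i * (A $ i * B $ j - B $ j * A $ i) = (if i = j \<and> odd i then - 2 else 0)"
begin

definition "E = fps_expo A"
definition "M = fps_expo B"

lemma exchange: "E $% (b + 1) * M $% a + E $% b * M $% (a - 1) = M $% a * E $% (b + 1) - M $% (a - 1) * E $% b"
  unfolding E_def M_def by (rule expo_exchange_int[OF A(1,2) B(1,2) comm])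

lemma homog_E: "homog n (E $% n)" and homog_M: "homog (- n) (M $% n)"
  using graded_int[OF graded_expo[OF A(3)], of n] graded_int[OF graded_expo[OF B(3)], of n]
  by (simp_all add: E_def M_def)

lemma graded_M: "graded (- 1) M"
  using graded_expo[OF B(3)] by (simp add: M_def)

lemma M_commute: "M $% a * M $% b = M $% b * M $% a"
  using coeffs_commute_fps_expo[OF coeffs_commute_sym[OF coeffs_commute_fps_expo[OF B(2)]]]
  by (simp add: M_def int_nth_def coeffs_commute_def)

lemma E_commute: "E $% a * E $% b = E $% b * E $% a"
  using coeffs_commute_fps_expo[OF coeffs_commute_sym[OF coeffs_commute_fps_expo[OF A(2)]]]
  by (simp add: E_def int_nth_def coeffs_commute_def)

text \<open>The coefficient of \<open>z\<^sup>-\<^sup>p w\<^sup>-\<^sup>q\<close> in the normally ordered product \<open>M(z) M(w) E(z) E(w)\<close>.\<close>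

definition normal :: "int \<Rightarrow> int \<Rightarrow> ('i \<Rightarrow> 'k) \<Rightarrow> 'i \<Rightarrow> 'k" where
  "normal p q G m = (\<Sum>a\<in>{0..int (wt m)}. \<Sum>b\<in>{0..int (wt m)}.
     app (M $% a * M $% b * (E $% (a + p) * E $% (b + q))) G m)"

lemma normal_superset:
  assumes "int (wt m) \<le> W" "int (wt m) \<le> U"
  shows "normal p q G m = (\<Sum>a\<in>{0..W}. \<Sum>b\<in>{0..U}.
     app (M $% a * M $% b * (E $% (a + p) * E $% (b + q))) G m)"
proof -
  have 0: "app (M $% a * M $% b * T) G m = 0" if "a + b > int (wt m)" for a b T
    unfolding app_mult[of "M $% a * M $% b"]
    by (rule homog_neg[OF homog_mult[OF homog_M homog_M]]) (use that in auto)
  have "normal p q G m = (\<Sum>a\<in>{0..int (wt m)}. \<Sum>b\<in>{0..U}.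
     app (M $% a * M $% b * (E $% (a + p) * E $% (b + q))) G m)"
    unfolding normal_def
    by (intro sum.cong refl sum.mono_neutral_left) (use assms 0 in auto)
  also have "\<dots> = (\<Sum>a\<in>{0..W}. \<Sum>b\<in>{0..U}.
     app (M $% a * M $% b * (E $% (a + p) * E $% (b + q))) G m)"
    by (intro sum.mono_neutral_left ballI sum.neutral) (use assms 0 in auto)
  finally show ?thesis .
qed

lemma normal_sym: "normal p q G m = normal q p G m"
  unfolding normal_def
  by (subst sum.swap) (simp add: M_commute E_commute)

lemma normal_eq_0:
  assumes "p < - int (wt m) \<or> q < - int (wt m)"
  shows "normal p q G m = 0"
  unfolding normal_def by (intro sum.neutral ballI) (use assms in auto)

text \<open>The coefficient of \<open>z\<^sup>-\<^sup>i w\<^sup>-\<^sup>j\<close> in the product \<open>M(z) E(z) M(w) E(w)\<close>, truncated in the second factor.\<close>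

definition product :: "int \<Rightarrow> int \<Rightarrow> int \<Rightarrow> ('i \<Rightarrow> 'k) \<Rightarrow> 'i \<Rightarrow> 'k" where
  "product U i j G m = (\<Sum>a\<in>{0..int (wt m)}. \<Sum>b\<in>{0..U}.
     app (M $% a * E $% (a + i) * M $% b * E $% (b + j)) G m)"

text \<open>The coefficient of z^(-i) y^(-j) in (z + y) X(z) X(y) = (z - y) :X(z) X(y):. The factor
  \<open>M $% b\<close> acts after E has raised the weight to at most wt m + i in total, so it
  vanishes for b > wt m + i and U is a sufficient bound.\<close>

lemma product_add:
  assumes "int (wt m) + i < U" "int (wt m) < U"
  shows "product U (i + 1) j G m + product U i (j + 1) G m = normal (i + 1) j G m - normal i (j + 1) G m"
proof -
  define W where "W = int (wt m)"
  have U: "0 \<le> U" using assms by linarith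
  \<comment> \<open>The shift of b loses nothing at the ends: \<open>M $% (- 1)\<close> is 0, and
    the term with \<open>M $% U\<close> vanishes by weight.\<close>
  have 1: "(\<Sum>b\<in>{0..U}. app (M $% a * E $% (a + i) * M $% b * E $% (b + (j + 1))) G m)
      = (\<Sum>b\<in>{0..U}. app (M $% a * E $% (a + i) * M $% (b - 1) * E $% (b + j)) G m)" for a
  proof -
    have "app (M $% a * E $% (a + i) * M $% U * E $% (U + 1 + j)) G m = 0"
      unfolding app_mult[of "M $% a * E $% (a + i) * M $% U"]
      by (rule homog_neg[OF homog_mult[OF homog_mult[OF homog_M homog_E] homog_M]]) (use assms in auto)
    then show ?thesis
      using sum_int_shift[of "\<lambda>b. app (M $% a * E $% (a + i) * M $% (b - 1) * E $% (b + j)) G m" U] U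
      by (simp add: ac_simps)
  qed
  have 2: "(\<Sum>b\<in>{0..U}. app (M $% a * M $% b * (E $% (a + i) * E $% (b + (j + 1)))) G m)
      = (\<Sum>b\<in>{0..U}. app (M $% a * M $% (b - 1) * (E $% (a + i) * E $% (b + j))) G m)" if "0 \<le> a" for a
  proof -
    have "app (M $% a * M $% U * (E $% (a + i) * E $% (U + 1 + j))) G m = 0"
      unfolding app_mult[of "M $% a * M $% U"]
      by (rule homog_neg[OF homog_mult[OF homog_M homog_M]]) (use assms that in auto)
    then show ?thesis
      using sum_int_shift[of "\<lambda>b. app (M $% a * M $% (b - 1) * (E $% (a + i) * E $% (b + j))) G m" U] U
      by (simp add: ac_simps)
  qed
  have ex: "M $% a * E $% (a + (i + 1)) * M $% b * E $% (b + j) + M $% a * E $% (a + i) * M $% (b - 1) * E $% (b + j)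
      = M $% a * M $% b * (E $% (a + (i + 1)) * E $% (b + j)) - M $% a * M $% (b - 1) * (E $% (a + i) * E $% (b + j))" for a b
  proof -
    have "M $% a * (E $% (a + i + 1) * M $% b + E $% (a + i) * M $% (b - 1)) * E $% (b + j)
        = M $% a * (M $% b * E $% (a + i + 1) - M $% (b - 1) * E $% (a + i)) * E $% (b + j)"
      by (simp only: exchange)
    then show ?thesis
      by (simp add: distrib_left distrib_right left_diff_distrib right_diff_distrib mult.assoc add.assoc)
  qed
  have "product U (i + 1) j G m + product U i (j + 1) G m
     = (\<Sum>a\<in>{0..W}. \<Sum>b\<in>{0..U}. app (M $% a * E $% (a + (i + 1)) * M $% b * E $% (b + j)
         + M $% a * E $% (a + i) * M $% (b - 1) * E $% (b + j)) G m)"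
    by (simp add: product_def W_def 1 app_add sum.distrib)
  also have "\<dots> = (\<Sum>a\<in>{0..W}. \<Sum>b\<in>{0..U}. app (M $% a * M $% b * (E $% (a + (i + 1)) * E $% (b + j))) G m)
     - (\<Sum>a\<in>{0..W}. \<Sum>b\<in>{0..U}. app (M $% a * M $% (b - 1) * (E $% (a + i) * E $% (b + j))) G m)"
    by (simp add: ex app_diff sum_subtractf)
  also have "\<dots> = normal (i + 1) j G m - normal i (j + 1) G m"
    using assms(2) by (subst (1 2) normal_superset[of m W U]) (simp_all add: W_def 2)
  finally show ?thesis .
qed

text \<open>The inner sum is the coefficient of y^(-j) in X(y) G, cut at U. Only its values in
  weight wt m + i enter, and for these U is large enough.\<close>

lemma product_eq_0:
  assumes "\<And>m. bracket M E j G m = 0" "int (wt m) + i \<le> U"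
  shows "product U i j G m = 0"
proof -
  have "(\<Sum>b\<in>{0..U}. app (M $% a * E $% (a + i) * M $% b * E $% (b + j)) G m) = 0" for a
  proof -
    have "(\<Sum>b\<in>{0..U}. app (M $% a * E $% (a + i) * M $% b * E $% (b + j)) G m)
      = app (M $% a * E $% (a + i)) (\<lambda>m. \<Sum>b\<in>{0..U}. app (M $% b * E $% (b + j)) G m) m"
      unfolding app_arg_sum by (simp add: app_mult)
    also have "\<dots> = 0"
    proof (rule homogD[OF homog_mult[OF homog_M homog_E]])
      fix l assume "int (wt l) = int (wt m) + (- a + (a + i))"
      then show "(\<Sum>b\<in>{0..U}. app (M $% b * E $% (b + j)) G l) = 0"
        using assms by (simp flip: bracket_superset[OF graded_M])
    qed
    finally show ?thesis .
  qed
  then show ?thesis unfolding product_def by (intro sum.neutral) blast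
qed

context
  fixes G :: "'i \<Rightarrow> 'k"
  assumes annihilated: "\<And>j m. odd j \<Longrightarrow> j > 0 \<Longrightarrow> bracket M E j G m = 0"
begin

text \<open>The odd part in both variables of \<open>(z - w)\<^sup>2 M(z) M(w) E(z) E(w) G\<close>, which equals that of
  \<open>(z\<^sup>2 - w\<^sup>2) M(z) E(z) M(w) E(w) G\<close>, has only positive powers of \<open>w\<close>.  As it is
  symmetric, it has only positive powers of \<open>z\<close>, too.\<close>

lemma second_difference_eq_0:
  assumes "odd i" "odd j" "i > 0 \<or> j > 0"
  shows "normal (i + 2) j G m - 2 * normal (i + 1) (j + 1) G m + normal i (j + 2) G m = 0"
proof -
  have *: "normal (i + 2) j G m - 2 * normal (i + 1) (j + 1) G m + normal i (j + 2) G m = 0"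
    if "odd j" "j > 0" for i j
  proof -
    define U where "U = int (wt m) + \<bar>i\<bar> + 3"
    have "product U (i + 1 + 1) j G m + product U (i + 1) (j + 1) G m
        = normal (i + 1 + 1) j G m - normal (i + 1) (j + 1) G m"
      by (rule product_add) (auto simp: U_def)
    moreover have "product U (i + 1) (j + 1) G m + product U i (j + 1 + 1) G m
        = normal (i + 1) (j + 1) G m - normal i (j + 1 + 1) G m"
      by (rule product_add) (auto simp: U_def)
    \<comment> \<open>The outer products have odd positive second index. The middle one, of even
      index j + 1, is unknown but cancels, as z^2 - y^2 has no mixed term.\<close>
    moreover have "product U (i + 1 + 1) j G m = 0" "product U i (j + 1 + 1) G m = 0"
      using that by (auto intro!: product_eq_0 annihilated simp: U_def)
    ultimately have "normal (i + 2) j G m = product U (i + 1) (j + 1) G m + normal (i + 1) (j + 1) G m"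
      "normal i (j + 2) G m = normal (i + 1) (j + 1) G m - product U (i + 1) (j + 1) G m"
      by (simp_all add: algebra_simps)
    then show ?thesis by (simp only:) (simp add: algebra_simps)
  qed
  show ?thesis
  proof (cases "j > 0")
    case False
    then show ?thesis
      using *[of i j] assms normal_sym[of i "j + 2"] normal_sym[of "i + 1" "j + 1"] normal_sym[of "i + 2" j]
      by (simp add: algebra_simps)
  qed (use * assms in blast)
qed

text \<open>Restricting \<open>\<partial>\<^sub>\<lambda> \<partial>\<^sub>\<mu>\<close> of the odd part (divided by \<open>zw\<close>, with \<open>\<lambda> = z\<^sup>2\<close> and \<open>\<mu> = w\<^sup>2\<close>) to the
  diagonal gives the coefficients below, where \<open>(i + 1)(j + 1) = 0\<close> for the remaining terms with \<open>i, j \<le> 0\<close>.\<close>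

lemma weighted_normal_sum_eq_0:
  assumes T: "even T" "T \<ge> - 2" and W: "W = int (wt m)"
  shows "(\<Sum>p\<in>{- W..T + W}. of_int ((if even p then 1 else - 1) * (p * (T - p)) + (if odd p then 1 else 0))
           * normal p (T - p) G m) = 0"
proof -
  define f where "f p = normal p (T - p) G m" for p
  define u :: "int \<Rightarrow> int" where "u i = (if odd i then (i + 1) * (T - 1 - i) else 0)" for i
  have f0: "f p = 0" if "p \<notin> {- W..T + W}" for p
    unfolding f_def by (rule normal_eq_0) (use that W in auto)
  \<comment> \<open>The range starts at -W - 2 so that it still covers the support of
    \<open>f\<close> after every shift by s \<le> 2.\<close>
  have shift: "(\<Sum>i\<in>{- W - 2..T + W}. of_int (u i) * f (i + s)) = (\<Sum>p\<in>{- W..T + W}. of_int (u (p - s)) * f p)"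
    if "s \<in> {0..2}" for s
  proof -
    have "(\<Sum>i\<in>{- W - 2..T + W}. of_int (u i) * f (i + s)) = (\<Sum>p\<in>{- W - 2 + s..T + W + s}. of_int (u (p - s)) * f p)"
      by (rule sum.reindex_bij_witness[of _ "\<lambda>p. p - s" "\<lambda>i. i + s"]) auto
    also have "\<dots> = (\<Sum>p\<in>{- W..T + W}. of_int (u (p - s)) * f p)"
      by (rule sum.mono_neutral_right) (use that f0 in auto)
    finally show ?thesis .
  qed
  have zero: "of_int (u i) * (f (i + 2) - 2 * f (i + 1) + f i) = 0" for i
  proof (cases "odd i \<and> (i > 0 \<or> T - 2 - i > 0)")
    case True
    then have "f (i + 2) - 2 * f (i + 1) + f i = 0"
      unfolding f_def using second_difference_eq_0[of i "T - 2 - i" m] T(1)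
      by (simp add: algebra_simps)
    then show ?thesis by simp
  next
    case False
    \<comment> \<open>For odd i put j = T - 2 - i. Both are odd and at most 0, and i + j \<ge> -4
      forces one of them to be -1. The bound T \<ge> -2 is exactly what this takes.\<close>
    have "u i = 0"
    proof (rule ccontr)
      assume *: "u i \<noteq> 0"
      then have i: "odd i" "i \<le> 0" "T - 2 \<le> i" "i \<noteq> - 1" "i \<noteq> T - 1"
        using False by (auto simp: u_def split: if_splits)
      moreover have "odd (T - 1)" using T by simp
      ultimately have "i \<le> - 3" "T - 1 \<le> i"
        by presburger+
      then show False using T i by presburger
    qed
    then show ?thesis by simp
  qed
  have "0 = (\<Sum>i\<in>{- W - 2..T + W}. of_int (u i) * (f (i + 2) - 2 * f (i + 1) + f (i + 0)))"
    by (intro sum.neutral[symmetric] ballI) (simp only: add_0_right zero)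
  also have "\<dots> = (\<Sum>i\<in>{- W - 2..T + W}. of_int (u i) * f (i + 2))
     - 2 * (\<Sum>i\<in>{- W - 2..T + W}. of_int (u i) * f (i + 1))
     + (\<Sum>i\<in>{- W - 2..T + W}. of_int (u i) * f (i + 0))"
    unfolding sum_distrib_left sum.distrib[symmetric] sum_subtractf[symmetric]
    by (intro sum.cong refl) (simp add: algebra_simps)
  also have "\<dots> = (\<Sum>p\<in>{- W..T + W}. of_int (u (p - 2) - 2 * u (p - 1) + u p) * f p)"
    by (subst (1 2 3) shift) (simp_all add: algebra_simps sum.distrib sum_subtractf sum_distrib_left)
  \<comment> \<open>Summation by parts has moved the second difference to \<open>u\<close>. For even
    p only the middle term -2 p (T - p) is left, for odd p the outer two, with sum 2 p (T - p) -
    2.\<close>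
  also have "\<dots> = (\<Sum>p\<in>{- W..T + W}. - 2 * (of_int ((if even p then 1 else - 1) * (p * (T - p)) + (if odd p then 1 else 0)) * f p))"
  proof (rule sum.cong[OF refl])
    fix p
    have "u (p - 2) - 2 * u (p - 1) + u p
        = - 2 * ((if even p then 1 else - 1) * (p * (T - p)) + (if odd p then 1 else 0))"
      by (simp add: u_def algebra_simps)
    then show "of_int (u (p - 2) - 2 * u (p - 1) + u p) * f p
        = - 2 * (of_int ((if even p then 1 else - 1) * (p * (T - p)) + (if odd p then 1 else 0)) * f p)"
      by (simp only: of_int_mult[of "- 2"] of_int_neg_numeral mult.assoc)
  qed
  also have "\<dots> = - 2 * (\<Sum>p\<in>{- W..T + W}. of_int ((if even p then 1 else - 1) * (p * (T - p)) + (if odd p then 1 else 0)) * f p)"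
    by (simp only: sum_distrib_left)
  finally show ?thesis by (simp add: f_def)
qed

text \<open>The weights of the preceding sum correspond to three restrictions to z = y of N(z, y) =
  :X(z) X(y): G, namely of N(z, y), of N(-z, y), and of N(-z, y) after z d/dz and y d/dy. The last
  is, up to sign, the normally ordered square of euler B - euler A, where the minus is due to A
  being a series in 1/z.\<close>

theorem bilinear_identity:
  assumes T: "even T" "T \<ge> - 2"
  shows "bracket (M * M) (E * E) T G m - (if T = 0 then G m else 0)
    = 2 * (bracket (euler B * euler B) 1 T G m - 2 * bracket (euler B) (euler A) T G m
        + bracket 1 (euler A * euler A) T G m)"
proof -
  define W where "W = int (wt m)"
  define sg :: "int \<Rightarrow> int" where "sg n = (if even n then 1 else - 1)" for n
  define M' E' where "M' = fps_alt M" and "E' = fps_alt E"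
  have alt: "M' $% n = of_int (sg n) * M $% n" "E' $% n = of_int (sg n) * E $% n" for n
    by (simp_all add: M'_def E'_def sg_def int_nth_fps_alt)
  have eul: "euler M' $% n = of_int (n * sg n) * M $% n" "euler E' $% n = of_int (n * sg n) * E $% n" for n
    unfolding int_nth_euler alt of_int_mult by (simp_all add: mult.assoc)
  have gr: "graded (- 1) M'" "graded (- 1) (euler M')" "graded (- 1) (euler M)"
    using graded_M by (simp_all add: M'_def graded_alt graded_euler)
  define S where "S f1 f2 g1 g2 = (\<Sum>p\<in>{- W..T + W}. \<Sum>a\<in>{0..W}. \<Sum>b\<in>{0..W}.
      app (f1 $% a * f2 $% b * (g1 $% (a + p) * g2 $% (b + (T - p)))) G m)" for f1 f2 g1 g2
  have S: "S f1 f2 g1 g2 = bracket (f1 * f2) (g1 * g2) T G m" if "graded (- 1) f1" "graded (- 1) f2" for f1 f2 g1 g2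
    unfolding S_def by (rule bracket_diagonal[OF that]) (simp add: W_def)
  have n0: "of_int k * normal p (T - p) G m = (\<Sum>a\<in>{0..W}. \<Sum>b\<in>{0..W}.
      of_int k * app (M $% a * M $% b * (E $% (a + p) * E $% (b + (T - p)))) G m)" for k p
    by (simp add: normal_def W_def sum_distrib_left)
  have X: "(\<Sum>p\<in>{- W..T + W}. normal p (T - p) G m) = S M M E E"
    by (simp add: S_def normal_def W_def)
  \<comment> \<open>The sign comes from z^(-p) under z \<mapsto> -z and is distributed over z^a from
    M and z^(-a - p) from E.\<close>
  have sg: "sg a * sg (a + p) = sg p" for a p by (simp add: sg_def)
  have Y: "(\<Sum>p\<in>{- W..T + W}. of_int (sg p) * normal p (T - p) G m) = S M' M E' E"
    unfolding S_def n0 alt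
  proof (intro sum.cong refl)
    fix p a b
    show "of_int (sg p) * app (M $% a * M $% b * (E $% (a + p) * E $% (b + (T - p)))) G m
      = app (of_int (sg a) * M $% a * M $% b * (of_int (sg (a + p)) * E $% (a + p) * E $% (b + (T - p)))) G m"
      using app_of_int4[of "sg a" "M $% a" 1 "M $% b" "sg (a + p)" "E $% (a + p)" 1 "E $% (b + (T - p))" G m]
      by (simp add: sg flip: of_int_mult)
  qed
  \<comment> \<open>Writing p = (a + p) - a and T - p = (b + T - p) - b splits the weight into the
    Euler eigenvalues of the E and M factors.\<close>
  have Z: "(\<Sum>p\<in>{- W..T + W}. of_int (sg p * (p * (T - p))) * normal p (T - p) G m)
      = S M' M (euler E') (euler E) - S M' (euler M) (euler E') E
        - S (euler M') M E' (euler E) + S (euler M') (euler M) E' E"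
    unfolding S_def n0 eul
    unfolding int_nth_euler alt sum.distrib[symmetric] sum_subtractf[symmetric]
  proof (intro sum.cong refl)
    fix p a b
    let ?q = "T - p"
    let ?x = "app (M $% a * M $% b * (E $% (a + p) * E $% (b + ?q))) G m"
    have 1: "app (of_int (sg a) * M $% a * M $% b * (of_int ((a + p) * sg (a + p)) * E $% (a + p)
        * (of_int (b + ?q) * E $% (b + ?q)))) G m = of_int (sg p * ((a + p) * (b + ?q))) * ?x"
      using app_of_int4[of "sg a" "M $% a" 1 "M $% b" "(a + p) * sg (a + p)" "E $% (a + p)" "b + ?q" "E $% (b + ?q)" G m]
      by (simp only: of_int_1 mult_1 sg[symmetric, of p a] ac_simps)
    have 2: "app (of_int (sg a) * M $% a * (of_int b * M $% b) * (of_int ((a + p) * sg (a + p)) * E $% (a + p)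
        * E $% (b + ?q))) G m = of_int (sg p * ((a + p) * b)) * ?x"
      using app_of_int4[of "sg a" "M $% a" b "M $% b" "(a + p) * sg (a + p)" "E $% (a + p)" 1 "E $% (b + ?q)" G m]
      by (simp only: of_int_1 mult_1 sg[symmetric, of p a] ac_simps)
    have 3: "app (of_int (a * sg a) * M $% a * M $% b * (of_int (sg (a + p)) * E $% (a + p)
        * (of_int (b + ?q) * E $% (b + ?q)))) G m = of_int (sg p * (a * (b + ?q))) * ?x"
      using app_of_int4[of "a * sg a" "M $% a" 1 "M $% b" "sg (a + p)" "E $% (a + p)" "b + ?q" "E $% (b + ?q)" G m]
      by (simp only: of_int_1 mult_1 sg[symmetric, of p a] ac_simps)
    have 4: "app (of_int (a * sg a) * M $% a * (of_int b * M $% b) * (of_int (sg (a + p)) * E $% (a + p)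
        * E $% (b + ?q))) G m = of_int (sg p * (a * b)) * ?x"
      using app_of_int4[of "a * sg a" "M $% a" b "M $% b" "sg (a + p)" "E $% (a + p)" 1 "E $% (b + ?q)" G m]
      by (simp only: of_int_1 mult_1 sg[symmetric, of p a] ac_simps)
    have "sg p * (p * ?q) = sg p * ((a + p) * (b + ?q)) - sg p * ((a + p) * b) - sg p * (a * (b + ?q)) + sg p * (a * b)"
      by (simp add: algebra_simps)
    then show "of_int (sg p * (p * ?q)) * ?x
      = app (of_int (sg a) * M $% a * M $% b * (of_int ((a + p) * sg (a + p)) * E $% (a + p)
          * (of_int (b + ?q) * E $% (b + ?q)))) G m
        - app (of_int (sg a) * M $% a * (of_int b * M $% b) * (of_int ((a + p) * sg (a + p)) * E $% (a + p)
          * E $% (b + ?q))) G m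
        - app (of_int (a * sg a) * M $% a * M $% b * (of_int (sg (a + p)) * E $% (a + p)
          * (of_int (b + ?q) * E $% (b + ?q)))) G m
        + app (of_int (a * sg a) * M $% a * (of_int b * M $% b) * (of_int (sg (a + p)) * E $% (a + p)
          * E $% (b + ?q))) G m"
      unfolding 1 2 3 4 by (simp only: of_int_add of_int_diff distrib_right left_diff_distrib)
  qed
  note MM = fps_alt_expo_mult[OF B(1,2), folded M_def, folded M'_def]
    fps_alt_expo_euler[OF B(1,2), folded M_def, folded M'_def]
  note EE = fps_alt_expo_mult[OF A(1,2), folded E_def, folded E'_def]
    fps_alt_expo_euler[OF A(1,2), folded E_def, folded E'_def]
  have bn: "bracket f (- g) T G m = - bracket f g T G m" "bracket (- f) g T G m = - bracket f g T G m" for f g :: "('i, 'k) endo fps"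
    by (simp_all add: bracket_def int_nth_uminus app_uminus sum_negf)
  define J where "J = bracket (euler B * euler B) 1 T G m - 2 * bracket (euler B) (euler A) T G m
        + bracket 1 (euler A * euler A) T G m"
  have Z': "(\<Sum>p\<in>{- W..T + W}. of_int (sg p * (p * (T - p))) * normal p (T - p) G m) = - J"
    unfolding Z by (simp add: S gr graded_M MM EE bn J_def)
  have Y': "(\<Sum>p\<in>{- W..T + W}. of_int (sg p) * normal p (T - p) G m) = (if T = 0 then G m else 0)"
  proof -
    have "bracket 1 1 T G m = (\<Sum>c\<in>{0..W}. if c = 0 then app (1 $% T) G m else 0)"
      unfolding bracket_def W_def by (intro sum.cong refl) (simp add: int_nth_1)
    also have "\<dots> = (if T = 0 then G m else 0)"
      by (simp add: W_def int_nth_1)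
    finally show ?thesis unfolding Y by (simp add: S gr graded_M MM EE)
  qed
  have "0 = 2 * (\<Sum>p\<in>{- W..T + W}. of_int (sg p * (p * (T - p)) + (if odd p then 1 else 0)) * normal p (T - p) G m)"
    using weighted_normal_sum_eq_0[OF T W_def] by (simp add: sg_def)
  \<comment> \<open>Twice the indicator of odd p is 1 - \<open>sg p\<close>, so the sum splits into
    the three values already computed.\<close>
  also have "\<dots> = (\<Sum>p\<in>{- W..T + W}. 2 * (of_int (sg p * (p * (T - p))) * normal p (T - p) G m)
       + (normal p (T - p) G m - of_int (sg p) * normal p (T - p) G m))"
    unfolding sum_distrib_left
    by (intro sum.cong refl) (simp add: sg_def algebra_simps)
  also have "\<dots> = 2 * (- J) + (bracket (M * M) (E * E) T G m - (if T = 0 then G m else 0))"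
    unfolding sum.distrib sum_subtractf sum_distrib_left[symmetric] Z' Y' X
    by (simp add: S graded_M)
  finally show ?thesis by (simp add: J_def algebra_simps)
qed

end

end

subsection \<open>The oscillators\<close>

abbreviation unit_mono :: "nat \<Rightarrow> mono" where
  "unit_mono k \<equiv> Poly_Mapping.single k (Suc 0)"

abbreviation expt :: "mono \<Rightarrow> nat \<Rightarrow> nat" where
  "expt \<equiv> Poly_Mapping.lookup"

text \<open>x_k has weight 2k + 1, the exponent of z beside q_k and of 1/z beside its derivative in
  the vertex operator.\<close>

definition mono_wt :: "mono \<Rightarrow> nat" where
  "mono_wt m = (\<Sum>k\<in>Poly_Mapping.keys m. (2 * k + 1) * expt m k)"

lemma mono_wt_add_unit: "mono_wt (m + unit_mono k) = mono_wt m + (2 * k + 1)"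
proof -
  have superset: "mono_wt n = (\<Sum>j\<in>insert k (Poly_Mapping.keys m). (2 * j + 1) * expt n j)"
    if "Poly_Mapping.keys n \<subseteq> insert k (Poly_Mapping.keys m)" for n
    unfolding mono_wt_def by (rule sum.mono_neutral_left) (use that in \<open>auto simp: in_keys_iff\<close>)
  have "Poly_Mapping.keys (m + unit_mono k) \<subseteq> insert k (Poly_Mapping.keys m)"
    using Poly_Mapping.keys_add[of m "unit_mono k"] by auto
  then have "mono_wt (m + unit_mono k)
      = (\<Sum>j\<in>insert k (Poly_Mapping.keys m). (2 * j + 1) * expt m j + (if j = k then 2 * k + 1 else 0))"
    by (subst superset) (auto intro!: sum.cong simp: lookup_add lookup_single when_def algebra_simps)
  also have "\<dots> = mono_wt m + (2 * k + 1)"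
    unfolding sum.distrib superset[of m, OF subset_insertI] by (simp add: sum.delta)
  finally show ?thesis .
qed

lemma diff_unit_add: "expt m k > 0 \<Longrightarrow> m - unit_mono k + unit_mono k = m"
  by (rule poly_mapping_eqI) (auto simp: lookup_add lookup_minus lookup_single when_def)

lemma add_unit_diff: "m + unit_mono k - unit_mono k = m"
  by (rule poly_mapping_eqI) (auto simp: lookup_add lookup_minus lookup_single when_def)

lemma add_unit_diff_commute: "k \<noteq> l \<Longrightarrow> m + unit_mono k - unit_mono l = m - unit_mono l + unit_mono k"
  by (rule poly_mapping_eqI) (auto simp: lookup_add lookup_minus lookup_single when_def)

lemma diff_unit_commute: "m - unit_mono k - unit_mono l = m - unit_mono l - unit_mono k"
  by (rule poly_mapping_eqI) (auto simp: lookup_add lookup_minus lookup_single when_def)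

lemma add_unit_commute: "m + unit_mono k + unit_mono l = m + unit_mono l + unit_mono k"
  by (simp add: ac_simps)

lemma mono_wt_diff_unit: "expt m k > 0 \<Longrightarrow> mono_wt m = mono_wt (m - unit_mono k) + (2 * k + 1)"
  using mono_wt_add_unit[of "m - unit_mono k" k] by (simp only: diff_unit_add)

lemma expt_add_unit: "expt (m + unit_mono k) l = expt m l + (if k = l then 1 else 0)"
  by (simp add: lookup_add lookup_single when_def)

lemma expt_diff_unit: "expt (m - unit_mono k) l = expt m l - (if k = l then 1 else 0)"
  by (simp add: lookup_minus lookup_single when_def)

text \<open>The shift of \<open>q\<^sub>1\<close> cancels in \<open>q'\<^sub>1 - q''\<^sub>1\<close>.\<close>

lift_definition mul_diff :: "nat \<Rightarrow> (mono \<times> mono, 'k::field_char_0) endo" is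
  "\<lambda>k F (m, m'). (if expt m k > 0 then F (m - unit_mono k, m') else 0)
     - (if expt m' k > 0 then F (m, m' - unit_mono k) else 0)"
  by (auto simp: fun_eq_iff algebra_simps)

lift_definition der_diff :: "nat \<Rightarrow> (mono \<times> mono, 'k::field_char_0) endo" is
  "\<lambda>k F (m, m'). of_nat (expt m k + 1) * F (m + unit_mono k, m')
     - of_nat (expt m' k + 1) * F (m, m' + unit_mono k)"
  by (auto simp: fun_eq_iff algebra_simps)

lemma mul_diff_commute: "mul_diff k * mul_diff l = mul_diff l * mul_diff k"
proof (rule endo_eqI)
  fix F :: "mono \<times> mono \<Rightarrow> 'a" and i :: "mono \<times> mono"
  obtain m m' where i: "i = (m, m')" by fastforce
  show "app (mul_diff k * mul_diff l) F i = app (mul_diff l * mul_diff k) F i"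
    unfolding i app_mult mul_diff.rep_eq
    by (cases "k = l") (simp_all add: expt_diff_unit diff_unit_commute[of _ k l])
qed

lemma der_diff_commute: "der_diff k * der_diff l = der_diff l * der_diff k"
proof (rule endo_eqI)
  fix F :: "mono \<times> mono \<Rightarrow> 'a" and i :: "mono \<times> mono"
  obtain m m' where i: "i = (m, m')" by fastforce
  show "app (der_diff k * der_diff l) F i = app (der_diff l * der_diff k) F i"
    unfolding i app_mult der_diff.rep_eq
    by (cases "k = l") (simp_all add: expt_add_unit add_unit_commute[of _ k l] right_diff_distrib
        mult.left_commute del: of_nat_Suc of_nat_add)
qed

text \<open>Each tensor factor contributes 1, since in the second one the two minus signs
  cancel.\<close>

lemma der_mul_commutator:
  "der_diff k * mul_diff l - mul_diff l * der_diff k = (if k = l then 2 else 0)"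
proof (rule endo_eqI)
  fix F :: "mono \<times> mono \<Rightarrow> 'a" and i :: "mono \<times> mono"
  obtain m m' where i: "i = (m, m')" by fastforce
  have 2: "app 2 F i = 2 * F i"
    using app_of_int[of 2 1 F i] by simp
  show "app (der_diff k * mul_diff l - mul_diff l * der_diff k) F i = app (if k = l then 2 else 0) F i"
  proof (cases "k = l")
    case True
    then show ?thesis
      using 2 unfolding i app_mult app_diff der_diff.rep_eq mul_diff.rep_eq
      by (auto simp: expt_add_unit expt_diff_unit add_unit_diff diff_unit_add of_nat_diff ring_distribs)
  next
    case False
    then show ?thesis
      unfolding i app_mult app_diff der_diff.rep_eq mul_diff.rep_eq
      by (simp add: expt_add_unit expt_diff_unit add_unit_diff_commute ring_distribs)
  qed
qed

section \<open>Odd series of creation and annihilation operators\<close>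

definition pair_wt :: "mono \<times> mono \<Rightarrow> nat" where
  "pair_wt i = mono_wt (fst i) + mono_wt (snd i)"

interpretation weight pair_wt .

lemma homog_mul_diff: "homog (- int (2 * k + 1)) (mul_diff k)"
  unfolding homog_def mul_diff.rep_eq
  by (auto simp: pair_wt_def dest!: mono_wt_diff_unit)

lemma homog_der_diff: "homog (int (2 * k + 1)) (der_diff k)"
  unfolding homog_def der_diff.rep_eq
  by (auto simp: pair_wt_def mono_wt_add_unit)

definition odd_series :: "(nat \<Rightarrow> ('i, 'k::field_char_0) endo) \<Rightarrow> ('i, 'k) endo fps" where
  "odd_series T = Abs_fps (\<lambda>n. if odd n then T (n div 2) else 0)"

lemma odd_series_nth: "odd_series T $ n = (if odd n then T (n div 2) else 0)"
  by (simp add: odd_series_def)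

definition der_series :: "(nat \<Rightarrow> 'k) \<Rightarrow> (mono \<times> mono, 'k::field_char_0) endo fps" where
  "der_series x = odd_series (\<lambda>k. scal (x k) * der_diff k)"

definition mul_series :: "(nat \<Rightarrow> 'k) \<Rightarrow> (mono \<times> mono, 'k::field_char_0) endo fps" where
  "mul_series x = odd_series (\<lambda>k. scal (x k) * mul_diff k)"

lemma scal_mult_scal_mult: "scal a * S * (scal b * T) = scal (a * b) * (S * T)"
  unfolding scal_mult by (metis mult.assoc scal_commute)

lemma odd_der_series: "odd_fps (der_series x)" and odd_mul_series: "odd_fps (mul_series x)"
  by (simp_all add: odd_fps_def der_series_def mul_series_def odd_series_nth)

lemma commute_der_series: "coeffs_commute (der_series x) (der_series y)"
  by (auto simp: coeffs_commute_def der_series_def odd_series_nth scal_mult_scal_mult mult.commute[of "x _"]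
      der_diff_commute)

lemma commute_mul_series: "coeffs_commute (mul_series x) (mul_series y)"
  by (auto simp: coeffs_commute_def mul_series_def odd_series_nth scal_mult_scal_mult mult.commute[of "x _"]
      mul_diff_commute)

lemma graded_der_series: "graded 1 (der_series x)"
  unfolding graded_def der_series_def odd_series_nth
proof
  fix n
  have "homog (int n) (scal (x (n div 2)) * der_diff (n div 2))" if "odd n"
    using homog_mult[OF homog_scal[of "x (n div 2)"] homog_der_diff[of "n div 2"]] that
    by (simp add: odd_two_times_div_two_succ del: of_nat_Suc of_nat_add)
  then show "homog (1 * int n) (if odd n then scal (x (n div 2)) * der_diff (n div 2) else 0)"
    by (simp add: homog_0)
qed

lemma graded_mul_series: "graded (- 1) (mul_series x)"
  unfolding graded_def mul_series_def odd_series_nth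
proof
  fix n
  have "homog (- int n) (scal (x (n div 2)) * mul_diff (n div 2))" if "odd n"
    using homog_mult[OF homog_scal[of "x (n div 2)"] homog_mul_diff[of "n div 2"]] that
    by (simp add: odd_two_times_div_two_succ del: of_nat_Suc of_nat_add)
  then show "homog (- 1 * int n) (if odd n then scal (x (n div 2)) * mul_diff (n div 2) else 0)"
    by (simp add: homog_0)
qed

lemma der_series_add: "der_series (\<lambda>k. x k + y k) = der_series x + der_series y"
  by (rule fps_ext) (simp add: der_series_def odd_series_nth scal_add distrib_right)

lemma mul_series_add: "mul_series (\<lambda>k. x k + y k) = mul_series x + mul_series y"
  by (rule fps_ext) (simp add: mul_series_def odd_series_nth scal_add distrib_right)

lemma der_series_uminus: "der_series (\<lambda>k. - x k) = - der_series x"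
  by (rule fps_ext) (simp add: der_series_def odd_series_nth scal_uminus)

lemma mul_series_uminus: "mul_series (\<lambda>k. - x k) = - mul_series x"
  by (rule fps_ext) (simp add: mul_series_def odd_series_nth scal_uminus)

lemma euler_der_series: "euler (der_series x) = der_series (\<lambda>k. of_nat (2 * k + 1) * x k)"
proof (rule fps_ext)
  fix n
  show "euler (der_series x) $ n = der_series (\<lambda>k. of_nat (2 * k + 1) * x k) $ n"
    by (cases "odd n") (simp_all add: der_series_def odd_series_nth scal_mult scal_of_nat mult.assoc
        odd_two_times_div_two_succ del: of_nat_Suc of_nat_add)
qed

lemma euler_mul_series: "euler (mul_series x) = mul_series (\<lambda>k. of_nat (2 * k + 1) * x k)"
proof (rule fps_ext)
  fix n
  show "euler (mul_series x) $ n = mul_series (\<lambda>k. of_nat (2 * k + 1) * x k) $ n"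
    by (cases "odd n") (simp_all add: mul_series_def odd_series_nth scal_mult scal_of_nat mult.assoc
        odd_two_times_div_two_succ del: of_nat_Suc of_nat_add)
qed

text \<open>In degree i = 2k + 1 the commutator is 2 x_k y_k, so the hypothesis is the normalisation
  in which i times the commutator equals -2.\<close>

lemma heisenberg_series:
  assumes "\<And>k. of_nat (2 * k + 1) * (x k * y k) = - 1"
  shows "heisenberg pair_wt (der_series x) (mul_series y)"
proof unfold_locales
  fix i j
  have "der_series x $ i * mul_series y $ j - mul_series y $ j * der_series x $ i
     = (if odd i \<and> odd j then scal (x (i div 2) * y (j div 2))
          * (der_diff (i div 2) * mul_diff (j div 2) - mul_diff (j div 2) * der_diff (i div 2)) else 0)"
    by (simp add: der_series_def mul_series_def odd_series_nth scal_mult_scal_mult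
        mult.commute[of "y _"] right_diff_distrib)
  also have "\<dots> = (if i = j \<and> odd i then scal (x (i div 2) * y (i div 2)) * 2 else 0)"
    unfolding der_mul_commutator by (auto elim!: oddE)
  finally have *: "der_series x $ i * mul_series y $ j - mul_series y $ j * der_series x $ i
     = (if i = j \<and> odd i then scal (x (i div 2) * y (i div 2)) * 2 else 0)" .
  have "of_nat i * (scal (x (i div 2) * y (i div 2)) * 2) = - (2 :: (mono \<times> mono, 'a) endo)" if "odd i"
  proof -
    have "of_nat i * scal (x (i div 2) * y (i div 2)) = (scal (- 1) :: (mono \<times> mono, 'a) endo)"
      using assms[of "i div 2"] that
      by (simp add: odd_two_times_div_two_succ flip: scal_of_nat scal_mult del: of_nat_Suc of_nat_add)
    then show ?thesis by (simp add: scal_uminus flip: mult.assoc)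
  qed
  then show "of_nat i * (der_series x $ i * mul_series y $ j - mul_series y $ j * der_series x $ i)
     = (if i = j \<and> odd i then - 2 else 0)"
    unfolding * by (smt (verit) mult_zero_right)
qed (simp_all add: odd_der_series odd_mul_series commute_der_series commute_mul_series
      graded_der_series graded_mul_series)

text \<open>The k-th term has order at least k, so the sum converges w-adically and terms with k > N
  do not reach degree n.\<close>

lemma suminf_fls_nth:
  fixes f :: "nat \<Rightarrow> 'a::ab_group_add fls"
  assumes "\<And>k j. j < int k \<Longrightarrow> f k $$ j = 0" and n: "n \<le> int N"
  shows "suminf f $$ n = (\<Sum>k\<le>N. f k $$ n)"
proof -
  define L where "L = Abs_fls (\<lambda>j. \<Sum>k\<le>nat j. f k $$ j)"
  have L: "L $$ j = (\<Sum>k\<le>K. f k $$ j)" if "j \<le> int K" for j K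
  proof -
    have "L $$ j = (\<Sum>k\<le>nat j. f k $$ j)"
      unfolding L_def by (rule nth_Abs_fls_lower_bound[of 0]) (use assms(1) in auto)
    also have "\<dots> = (\<Sum>k\<le>K. f k $$ j)"
    proof (rule sum.mono_neutral_left)
      show "\<forall>k\<in>{..K} - {..nat j}. f k $$ j = 0"
        by (auto intro!: assms(1))
    qed (use that in auto)
    finally show ?thesis .
  qed
  have "dist (\<Sum>k<K. f k) L \<le> inverse (2 ^ K)" for K
  proof (cases "(\<Sum>k<K. f k) = L")
    case False
    have "((\<Sum>k<K. f k) - L) $$ j = 0" if "j < int K" for j
    proof -
      have "(\<Sum>k<K. f k) $$ j = (\<Sum>k\<le>K. f k $$ j)"
        using assms(1)[OF that] by (simp add: fls_nth_sum lessThan_Suc_atMost[symmetric])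
      then show ?thesis using L[of j K] that by simp
    qed
    then have "int K \<le> fls_subdegree ((\<Sum>k<K. f k) - L)"
      using False by (intro fls_subdegree_geI) auto
    then show ?thesis
      using False by (auto simp: dist_fls_def intro!: power_increasing le_imp_inverse_le)
  qed simp
  then have "(\<lambda>K. dist (\<Sum>k<K. f k) L) \<longlonglongrightarrow> 0"
    by (intro Lim_null_comparison[OF _ LIMSEQ_inverse_realpow_zero[of 2]] always_eventually) auto
  then have "(\<lambda>K. \<Sum>k<K. f k) \<longlonglongrightarrow> L"
    by (simp add: tendsto_dist_iff[of _ L])
  then have "suminf f = L"
    by (intro sums_unique[symmetric]) (simp add: sums_def)
  with L[OF n] show ?thesis by simp
qed

subsection \<open>Coefficients of the vertex operators\<close>

text \<open>The coefficient of w^n takes values in the field of Laurent series in h, over which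
  \<open>mul_diff\<close> and \<open>der_diff\<close> are linear; powers of w thereby become indices
  of series of endomorphisms.\<close>

definition slice :: "series2 \<Rightarrow> int \<Rightarrow> mono \<times> mono \<Rightarrow> complex fls" where
  "slice F n = (\<lambda>(m, m'). F m m' $$ n)"

lemma slice_apply: "slice F n (m, m') = F m m' $$ n"
  by (simp add: slice_def)

lemma cst_nth: "(cst c * f) $$ n = fls_const c * f $$ n"
  by (simp add: cst_def)

lemma w_power_nth: "(w_power e * f) $$ n = f $$ (n - e)"
  by (simp add: w_power_def fls_X_intpow_times_conv_shift)

lemma sqrt_hbar_nth: "(sqrt_hbar * f) $$ n = fls_X * f $$ n"
  by (simp add: sqrt_hbar_def)

lemma divide_sqrt_hbar_nth: "(f / sqrt_hbar) $$ n = f $$ n / fls_X"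
proof -
  have "f / sqrt_hbar = f * fls_const (1 / fls_X)"
    using fls_const_divide_const[of 1 "fls_X :: complex fls"] unfolding sqrt_hbar_def
    by (metis fls_const_1 times_divide_eq_right mult.right_neutral)
  then show ?thesis by (simp only: fls_mult_const_nth times_divide_eq_right mult_1_right)
qed

lemma of_nat_coef_nth: "((of_nat k :: coef) * f) $$ n = of_nat k * f $$ n"
  by (simp add: fls_of_nat)

definition hbar_der :: "(nat \<Rightarrow> complex) \<Rightarrow> (mono \<times> mono, complex fls) endo fps" where
  "hbar_der x = der_series (\<lambda>k. fls_const (x k) * fls_X)"

definition hbar_mul :: "(nat \<Rightarrow> complex) \<Rightarrow> (mono \<times> mono, complex fls) endo fps" where
  "hbar_mul x = mul_series (\<lambda>k. fls_const (x k) / fls_X)"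

lemma sum_odd_int:
  fixes f :: "int \<Rightarrow> 'a::comm_monoid_add"
  assumes "\<And>j. even j \<Longrightarrow> f j = 0" "\<And>k. k > N \<Longrightarrow> 2 * int k + 1 \<le> n \<Longrightarrow> f (2 * int k + 1) = 0"
    "\<And>j. j > n \<Longrightarrow> j \<le> 2 * int N + 1 \<Longrightarrow> f j = 0"
  shows "(\<Sum>k\<le>N. f (2 * int k + 1)) = (\<Sum>j\<in>{0..n}. f j)"
proof -
  have "(\<Sum>k\<le>N. f (2 * int k + 1)) = (\<Sum>j\<in>(\<lambda>k. 2 * int k + 1) ` {..N}. f j)"
    by (subst sum.reindex) (auto simp: inj_on_def)
  also have "\<dots> = (\<Sum>j\<in>{0..n} \<union> (\<lambda>k. 2 * int k + 1) ` {..N}. f j)"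
  proof (rule sum.mono_neutral_left)
    show "\<forall>j\<in>{0..n} \<union> (\<lambda>k. 2 * int k + 1) ` {..N} - (\<lambda>k. 2 * int k + 1) ` {..N}. f j = 0"
    proof
      fix j assume j: "j \<in> {0..n} \<union> (\<lambda>k. 2 * int k + 1) ` {..N} - (\<lambda>k. 2 * int k + 1) ` {..N}"
      show "f j = 0"
      proof (cases "even j")
        case False
        then obtain k where k: "j = 2 * int k + 1"
          using j by (metis Diff_iff UnE atLeastAtMost_iff nonneg_int_cases odd_two_times_div_two_succ pos_imp_zdiv_nonneg_iff zero_less_numeral)
        then have "k > N" using j by auto
        then show ?thesis using k j assms(2) by auto
      qed (use assms in auto)
    qed
  qed auto
  also have "\<dots> = (\<Sum>j\<in>{0..n}. f j)"
    by (rule sum.mono_neutral_right) (use assms(3) in auto)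
  finally show ?thesis .
qed

lemma odd_series_int_nth: "odd_series T $% (2 * int k + 1) = T k"
  and odd_series_int_nth_even: "even j \<Longrightarrow> odd_series T $% j = 0"
  by (auto simp: int_nth_def odd_series_nth nat_add_distrib nat_mult_distrib even_nat_iff)

text \<open>The offset s is 0 for the vertex operator and 2 for \<phi>, whose periods carry one more
  factor w^2. The k-th term raises the order in w by more than k and F has no negative powers,
  whence convergence.\<close>

lemma deriv_part_nth:
  assumes J: "\<And>k. J k = cst (x k) * w_power (2 * int k + 1 + s)" and "s \<ge> 0"
    and F: "\<And>m m' n. n < 0 \<Longrightarrow> F m m' $$ n = 0"
  shows "slice (on_factors c (- c) (deriv_part J) F) n (m, m')
    = (\<Sum>j\<in>{0..n}. app (hbar_der (\<lambda>k. c * ((- 1) ^ (k + 1) * x k)) $% j) (slice F (n - s - j)) (m, m'))"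
proof -
  define t where "t k = fls_const ((- 1) ^ (k + 1) * x k) * fls_X" for k
  define N where "N = nat n"
  have term_nth: "((- 1) ^ (k + 1) * J k * sqrt_hbar * deriv_q k G l) $$ j
      = t k * (of_nat (expt l k + 1) * G (l + unit_mono k) $$ (j - (2 * int k + 1 + s)))" for k G l j
  proof -
    have "(- 1) ^ (k + 1) * J k * sqrt_hbar * deriv_q k G l = cst ((- 1) ^ (k + 1) * x k) *
        (w_power (2 * int k + 1 + s) * (sqrt_hbar * (of_nat (expt l k + 1) * G (l + unit_mono k))))"
      by (cases "even k") (simp_all add: J deriv_q_def cst_def algebra_simps fls_const_uminus)
    then show ?thesis
      by (simp add: cst_nth w_power_nth sqrt_hbar_nth of_nat_coef_nth t_def mult.assoc del: of_nat_Suc of_nat_add)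
  qed
  have part: "deriv_part J G l $$ n = (\<Sum>k\<le>N. t k * (of_nat (expt l k + 1) * G (l + unit_mono k) $$ (n - (2 * int k + 1 + s))))"
    if "\<And>l n. n < 0 \<Longrightarrow> G l $$ n = 0" for G l
    unfolding deriv_part_def term_nth[symmetric]
  proof (rule suminf_fls_nth)
    fix k j assume "j < int k"
    then have "G (l + unit_mono k) $$ (j - (2 * int k + 1 + s)) = 0"
      using that assms(2) by simp
    then show "((- 1) ^ (k + 1) * J k * sqrt_hbar * deriv_q k G l) $$ j = 0"
      by (simp only: term_nth mult_zero_right)
  qed (simp add: N_def)
  define f where "f j = app (hbar_der (\<lambda>k. c * ((- 1) ^ (k + 1) * x k)) $% j) (slice F (n - s - j)) (m, m')" for j
  have f_odd: "f (2 * int k + 1) = fls_const c * (t k * (of_nat (expt m k + 1) * F (m + unit_mono k) m' $$ (n - (2 * int k + 1 + s))))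
      - fls_const c * (t k * (of_nat (expt m' k + 1) * F m (m' + unit_mono k) $$ (n - (2 * int k + 1 + s))))" for k
  proof -
    have n: "n - s - (2 * int k + 1) = n - (2 * int k + 1 + s)" by simp
    show ?thesis
      unfolding f_def hbar_der_def der_series_def odd_series_int_nth app_mult app_scal der_diff.rep_eq n
      by (simp add: slice_apply t_def right_diff_distrib fls_const_mult_const[symmetric] mult.assoc
          del: fls_const_mult_const of_nat_Suc of_nat_add)
  qed
  have "slice (on_factors c (- c) (deriv_part J) F) n (m, m') = (\<Sum>k\<le>N. f (2 * int k + 1))"
    unfolding slice_apply on_factors_def f_odd
    by (simp add: part F cst_nth sum_subtractf sum_distrib_left sum_negf fls_const_uminus)
  also have "\<dots> = (\<Sum>j\<in>{0..n}. f j)"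
  proof (rule sum_odd_int)
    show "f j = 0" if "even j" for j
      using that by (simp add: f_def hbar_der_def der_series_def odd_series_int_nth_even)
    show "f j = 0" if "j > n" for j
    proof -
      have "slice F (n - s - j) = (\<lambda>i. 0)"
        using that assms(2) by (auto simp: slice_def F)
      then show ?thesis by (simp add: f_def)
    qed
  qed (simp add: N_def)
  finally show ?thesis by (simp add: f_def)
qed

lemma expt_pos_imp_less_wt:
  assumes "expt m k > 0"
  shows "2 * k + 1 \<le> mono_wt m"
  using mono_wt_diff_unit[OF assms] by simp

text \<open>Here the powers of w decrease with k, and the sum is finite for another reason: x_k
  divides a monomial only if 2k + 1 is at most its weight. The contributions of the shift of q_1
  cancel between the two factors.\<close>

lemma mult_part_nth:
  assumes J: "\<And>k. J k = cst (x k) * w_power (s - (2 * int k + 1))" and W: "int (pair_wt (m, m')) \<le> W"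
  shows "slice (on_factors c (- c) (mult_part J) F) n (m, m')
    = (\<Sum>j\<in>{0..W}. app (hbar_mul (\<lambda>k. c * x k) $% j) (slice F (n - s + j)) (m, m'))"
proof -
  define t where "t k = fls_const (x k) / fls_X" for k
  \<comment> \<open>The successor keeps k = 1 in range even for W = 0, as the shift of q_1
    contributes at every monomial.\<close>
  define N where "N = Suc (nat W)"
  define low where "low k G l = (if expt l k > 0 then G (l - unit_mono k) else (0::coef))" for k and G :: series and l
  have term_nth: "(J k / sqrt_hbar * G) $$ j = t k * G $$ (j - s + (2 * int k + 1))" for k G j
  proof -
    have "J k / sqrt_hbar * G = cst (x k) * (w_power (s - (2 * int k + 1)) * G / sqrt_hbar)"
      by (simp add: J)
    moreover have "j - (s - (2 * int k + 1)) = j - s + (2 * int k + 1)" by simp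
    ultimately show ?thesis
      by (simp only: cst_nth divide_sqrt_hbar_nth w_power_nth t_def times_divide_eq_left times_divide_eq_right)
  qed
  have mult_q: "mult_q k G l = low k G l - (if k = 1 then G l else 0)" for k G l
    by (simp add: mult_q_def low_def)
  have part: "mult_part J G l = (\<Sum>k\<le>N. J k / sqrt_hbar * mult_q k G l)" if "int (mono_wt l) \<le> W" for G l
    unfolding mult_part_def
  proof (rule suminf_finite)
    fix k assume "k \<notin> {..N}"
    moreover have "expt l k = 0" if "k > nat W"
      using expt_pos_imp_less_wt[of l k] that \<open>int (mono_wt l) \<le> W\<close> by (cases "expt l k > 0") auto
    ultimately show "J k / sqrt_hbar * mult_q k G l = 0"
      by (auto simp: mult_q low_def N_def)
  qed simp
  define f where "f j = app (hbar_mul (\<lambda>k. c * x k) $% j) (slice F (n - s + j)) (m, m')" for j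
  have f_odd: "f (2 * int k + 1) = fls_const c * (t k * (low k (\<lambda>l. F l m') m - low k (F m) m') $$ (n - s + (2 * int k + 1)))" for k
  proof -
    have "fls_const (c * x k) / fls_X = fls_const c * t k"
      by (simp only: t_def times_divide_eq_right fls_const_mult_const)
    then show ?thesis
      unfolding f_def hbar_mul_def mul_series_def odd_series_int_nth app_mult app_scal mul_diff.rep_eq
      by (simp add: slice_apply low_def mult.assoc)
  qed
  have "slice (on_factors c (- c) (mult_part J) F) n (m, m')
      = (\<Sum>k\<le>N. cst c * (J k / sqrt_hbar * (low k (\<lambda>l. F l m') m - low k (F m) m'))) $$ n"
  proof -
    have "on_factors c (- c) (mult_part J) F m m'
      = (\<Sum>k\<le>N. cst c * (J k / sqrt_hbar * (mult_q k (\<lambda>l. F l m') m - mult_q k (F m) m')))"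
      using W unfolding on_factors_def
      by (simp add: part pair_wt_def sum_subtractf sum_distrib_left sum_negf cst_def fls_const_uminus right_diff_distrib)
    also have "\<dots> = (\<Sum>k\<le>N. cst c * (J k / sqrt_hbar * (low k (\<lambda>l. F l m') m - low k (F m) m')))"
      by (simp add: mult_q)
    finally show ?thesis by (simp add: slice_apply)
  qed
  also have "\<dots> = (\<Sum>k\<le>N. f (2 * int k + 1))"
    by (simp only: fls_nth_sum cst_nth term_nth f_odd)
  also have "\<dots> = (\<Sum>j\<in>{0..W}. f j)"
  proof (rule sum_odd_int)
    show "f j = 0" if "even j" for j
      using that by (simp add: f_def hbar_mul_def mul_series_def odd_series_int_nth_even)
    show "f j = 0" if "j > W" for j
      unfolding f_def hbar_mul_def
      by (rule homog_neg[OF graded_int[OF graded_mul_series]]) (use that W in auto)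
  qed (simp add: N_def)
  finally show ?thesis by (simp add: f_def)
qed

lemma period_der: "period (int k) = cst (of_real (sqrt (2 * pi)) / Gamma (1 / 2 - of_nat k)) * w_power (2 * int k + 1 + 0)"
  by (simp add: period_def)

lemma period_mul: "period (- int k - 1) = cst (of_real (sqrt (2 * pi)) / Gamma (of_nat k + 3 / 2)) * w_power (0 - (2 * int k + 1))"
proof -
  have 1: "1 / 2 - of_int (- int k - 1) = (of_nat k + 3 / 2 :: complex)" by simp
  have 2: "2 * (- int k - 1) + 1 = 0 - (2 * int k + 1)" by simp
  show ?thesis unfolding period_def 1 2 ..
qed

definition der_coeff :: "complex \<Rightarrow> nat \<Rightarrow> complex" where
  "der_coeff c k = c * ((- 1) ^ (k + 1) * (of_real (sqrt (2 * pi)) / Gamma (1 / 2 - of_nat k)))"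

definition mul_coeff :: "complex \<Rightarrow> nat \<Rightarrow> complex" where
  "mul_coeff c k = c * (of_real (sqrt (2 * pi)) / Gamma (of_nat k + 3 / 2))"

abbreviation "der_op c \<equiv> on_factors c (- c) (deriv_part (\<lambda>k. period (int k)))"
abbreviation "mul_op c \<equiv> on_factors c (- c) (mult_part (\<lambda>k. period (- int k - 1)))"

lemma der_op_power_nth:
  assumes "F = (\<lambda>m m'. fls_const (g (m, m')))"
  shows "slice ((der_op c ^^ r) F) n (m, m') = app ((hbar_der (der_coeff c) ^ r) $% n) g (m, m')"
proof (induction r arbitrary: n m m')
  case 0
  show ?case by (simp add: assms slice_apply int_nth_1)
next
  case (Suc r)
  have neg: "(der_op c ^^ r) F m m' $$ n = 0" if "n < 0" for m m' n
    using Suc[of n m m'] that by (simp add: slice_apply)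
  have "slice ((der_op c ^^ Suc r) F) n (m, m')
     = (\<Sum>j\<in>{0..n}. app (hbar_der (der_coeff c) $% j) (slice ((der_op c ^^ r) F) (n - 0 - j)) (m, m'))"
    unfolding funpow.simps o_apply der_coeff_def
    by (rule deriv_part_nth[OF period_der]) (use neg in auto)
  also have "\<dots> = (\<Sum>j\<in>{0..n}. app (hbar_der (der_coeff c) $% j * (hbar_der (der_coeff c) ^ r) $% (n - j)) g (m, m'))"
  proof (intro sum.cong refl)
    fix j
    have "slice ((der_op c ^^ r) F) (n - 0 - j) = app ((hbar_der (der_coeff c) ^ r) $% (n - j)) g"
      using Suc by (auto simp: fun_eq_iff)
    then show "app (hbar_der (der_coeff c) $% j) (slice ((der_op c ^^ r) F) (n - 0 - j)) (m, m')
       = app (hbar_der (der_coeff c) $% j * (hbar_der (der_coeff c) ^ r) $% (n - j)) g (m, m')"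
      by (simp only: app_mult)
  qed
  also have "\<dots> = app ((hbar_der (der_coeff c) ^ Suc r) $% n) g (m, m')"
    by (simp add: int_nth_mult app_sum)
  finally show ?case .
qed

lemma hbar_der_0: "hbar_der x $ 0 = 0" and hbar_mul_0: "hbar_mul x $ 0 = 0"
  by (simp_all only: hbar_der_def hbar_mul_def odd_fps_0 odd_der_series odd_mul_series)

lemma int_nth_fps_expo:
  assumes "A $ 0 = 0" "n \<le> int N"
  shows "fps_expo A $% n = (\<Sum>r\<le>N. scal (1 / fact r) * (A ^ r) $% n)"
  using fps_expo_nth[OF assms(1), of "nat n" N] assms(2) by (simp add: int_nth_def nat_le_iff)

lemma inverse_fact_nth: "(cst (1 / fact r) * f) $$ n = 1 / fact r * f $$ n"
proof -
  have "fls_const (1 / fact r) = (1 / fact r :: complex fls)"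
    by (simp add: fact_prod fls_of_nat flip: fls_const_divide_const)
  then show ?thesis by (simp add: cst_nth)
qed

lemma op_exp_der_nth:
  assumes "F = (\<lambda>m m'. fls_const (g (m, m')))"
  shows "slice (op_exp (der_op c) F) n (m, m') = app (fps_expo (hbar_der (der_coeff c)) $% n) g (m, m')"
proof -
  have nth: "(cst (1 / fact r) * (der_op c ^^ r) F m m') $$ j
      = app (scal (1 / fact r) * (hbar_der (der_coeff c) ^ r) $% j) g (m, m')" for r j
    using der_op_power_nth[OF assms, where m = m and m' = m']
    by (simp add: inverse_fact_nth slice_apply app_mult app_scal)
  have "slice (op_exp (der_op c) F) n (m, m') = (\<Sum>r\<le>nat n. (cst (1 / fact r) * (der_op c ^^ r) F m m') $$ n)"
    unfolding slice_apply op_exp_def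
  proof (rule suminf_fls_nth)
    fix r j assume "j < int r"
    then have "(hbar_der (der_coeff c) ^ r) $% j = 0"
      by (auto simp: int_nth_def intro!: power_nth_eq_0 hbar_der_0)
    then show "(cst (1 / fact r) * (der_op c ^^ r) F m m') $$ j = 0"
      by (simp add: nth)
  qed simp
  also have "\<dots> = app (fps_expo (hbar_der (der_coeff c)) $% n) g (m, m')"
    unfolding nth by (subst int_nth_fps_expo[OF hbar_der_0, where N = "nat n"]) (simp_all add: app_sum)
  finally show ?thesis .
qed

text \<open>W is fixed while the monomials vary: a coefficient of degree j reads values in weight
  lower by j, for which the same bound holds.\<close>

lemma mul_op_power_nth:
  assumes W: "int (pair_wt (m, m')) \<le> W"
  shows "slice ((mul_op c ^^ r) F) n (m, m')
    = (\<Sum>a\<in>{0..W}. app ((hbar_mul (mul_coeff c) ^ r) $% a) (slice F (n + a)) (m, m'))"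
  using W
proof (induction r arbitrary: n m m')
  case 0
  then have "0 \<le> W" by linarith
  have "(\<Sum>a\<in>{0..W}. app ((hbar_mul (mul_coeff c) ^ 0) $% a) (slice F (n + a)) (m, m'))
     = (\<Sum>a\<in>{0..W}. if a = 0 then slice F (n + a) (m, m') else 0)"
    by (intro sum.cong) (auto simp: int_nth_1)
  also have "\<dots> = slice F n (m, m')"
    using \<open>0 \<le> W\<close> by simp
  finally show ?case by simp
next
  case (Suc r)
  let ?B = "hbar_mul (mul_coeff c)"
  have gr: "graded (- 1) ?B" by (simp add: hbar_mul_def graded_mul_series)
  have "slice ((mul_op c ^^ Suc r) F) n (m, m')
     = (\<Sum>j\<in>{0..W}. app (?B $% j) (slice ((mul_op c ^^ r) F) (n - 0 + j)) (m, m'))"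
    unfolding funpow.simps o_apply mul_coeff_def
    by (rule mult_part_nth[OF period_mul Suc.prems])
  also have "\<dots> = (\<Sum>j\<in>{0..W}. \<Sum>a\<in>{0..W}. app (?B $% j * (?B ^ r) $% a) (slice F (n + (j + a))) (m, m'))"
  proof (intro sum.cong refl)
    fix j assume j: "j \<in> {0..W}"
    have "app (?B $% j) (slice ((mul_op c ^^ r) F) (n - 0 + j)) (m, m')
       = app (?B $% j) (\<lambda>i. \<Sum>a\<in>{0..W}. app ((?B ^ r) $% a) (slice F (n + (j + a))) i) (m, m')"
    proof (rule homog_cong[OF graded_int[OF gr]])
      fix i assume "int (pair_wt i) = int (pair_wt (m, m')) + - 1 * j"
      then have "int (pair_wt (fst i, snd i)) \<le> W" using j Suc.prems by simp
      from Suc.IH[OF this, of "n + j"]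
      show "slice ((mul_op c ^^ r) F) (n - 0 + j) i = (\<Sum>a\<in>{0..W}. app ((?B ^ r) $% a) (slice F (n + (j + a))) i)"
        by (simp add: add.assoc)
    qed
    then show "app (?B $% j) (slice ((mul_op c ^^ r) F) (n - 0 + j)) (m, m')
       = (\<Sum>a\<in>{0..W}. app (?B $% j * (?B ^ r) $% a) (slice F (n + (j + a))) (m, m'))"
      by (simp only: app_arg_sum app_mult)
  qed
  also have "\<dots> = (\<Sum>a\<in>{0..W}. app ((?B * ?B ^ r) $% a) (slice F (n + a)) (m, m'))"
    by (rule conv_sum[OF gr graded_power[OF gr] Suc.prems])
  finally show ?case by simp
qed

lemma op_exp_mul_nth:
  "slice (op_exp (mul_op c) F) n (m, m')
    = (\<Sum>a\<in>{0..int (pair_wt (m, m'))}. app (fps_expo (hbar_mul (mul_coeff c)) $% a) (slice F (n + a)) (m, m'))"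
proof -
  define W where "W = int (pair_wt (m, m'))"
  let ?B = "hbar_mul (mul_coeff c)"
  have nth: "(cst (1 / fact r) * (mul_op c ^^ r) F m m') $$ j
      = (\<Sum>a\<in>{0..W}. app (scal (1 / fact r) * (?B ^ r) $% a) (slice F (j + a)) (m, m'))" for r j
    using mul_op_power_nth[of m m' W r c F j]
    by (simp add: W_def inverse_fact_nth slice_apply app_mult app_scal sum_distrib_left)
  have "op_exp (mul_op c) F m m' = (\<Sum>r\<le>nat W. cst (1 / fact r) * (mul_op c ^^ r) F m m')"
    unfolding op_exp_def
  proof (rule suminf_finite)
    fix r assume r: "r \<notin> {..nat W}"
    have "(?B ^ r) $% a = 0" if "a \<le> W" for a
      using that r by (auto simp: int_nth_def intro!: power_nth_eq_0 hbar_mul_0)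
    then show "cst (1 / fact r) * (mul_op c ^^ r) F m m' = 0"
      by (intro fls_eqI) (simp add: nth)
  qed simp
  then have "slice (op_exp (mul_op c) F) n (m, m')
      = (\<Sum>r\<le>nat W. \<Sum>a\<in>{0..W}. app (scal (1 / fact r) * (?B ^ r) $% a) (slice F (n + a)) (m, m'))"
    by (simp add: slice_apply fls_nth_sum nth)
  also have "\<dots> = (\<Sum>a\<in>{0..W}. app (fps_expo ?B $% a) (slice F (n + a)) (m, m'))"
    by (subst sum.swap) (intro sum.cong refl, subst int_nth_fps_expo[OF hbar_mul_0, where N = "nat W"],
        auto simp: app_sum)
  finally show ?thesis by (simp add: W_def)
qed

text \<open>Creation in degree a carries z^a = w^(-a), so in the coefficient of w^n it is paired
  with annihilation in degree n + a.\<close>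

lemma vertex2_nth:
  assumes "F = (\<lambda>m m'. fls_const (g (m, m')))"
  shows "vertex2 c (- c) F m m' $$ n
    = bracket (fps_expo (hbar_mul (mul_coeff c))) (fps_expo (hbar_der (der_coeff c))) n g (m, m')"
proof -
  have sl: "slice (op_exp (der_op c) F) k = app (fps_expo (hbar_der (der_coeff c)) $% k) g" for k
    using op_exp_der_nth[OF assms] by (auto simp: fun_eq_iff)
  have "vertex2 c (- c) F m m' $$ n = slice (op_exp (mul_op c) (op_exp (der_op c) F)) n (m, m')"
    by (simp add: vertex2_def slice_apply)
  then show ?thesis
    unfolding op_exp_mul_nth sl bracket_def by (simp add: app_mult add.commute)
qed

subsection \<open>Passage to the given operators\<close>

lemma of_nat_plus_half_nonzero: "(of_nat k + 1 / 2 :: complex) \<noteq> 0"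
proof
  assume "(of_nat k + 1 / 2 :: complex) = 0"
  then have "Re (of_nat k + 1 / 2) = 0" by simp
  then show False by simp
qed

lemma Gamma_plus_three_halves: "Gamma (of_nat k + 3 / 2 :: complex) = (of_nat k + 1 / 2) * Gamma (of_nat k + 1 / 2)"
proof -
  have "Re (of_nat k + 1 / 2) > 0" by simp
  then have "(of_nat k + 1 / 2 :: complex) \<notin> \<int>\<^sub>\<le>\<^sub>0"
    by (metis nonpos_Ints_cases complex_Re_of_int not_less of_int_le_0_iff)
  from Gamma_plus1[OF this] show ?thesis by (simp add: add.assoc)
qed

lemma Gamma_half_reflection: "Gamma (1 / 2 - of_nat k :: complex) * Gamma (of_nat k + 1 / 2) = (- 1) ^ k * of_real pi"
proof -
  have "sin (of_real pi * (of_nat k + 1 / 2) :: complex) = of_real (sin (pi / 2 + of_nat k * pi))"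
    by (simp add: sin_of_real[symmetric] algebra_simps)
  also have "sin (pi / 2 + of_nat k * pi) = (- 1) ^ k"
    by (simp add: sin_add mult.commute)
  finally have "sin (of_real pi * (of_nat k + 1 / 2) :: complex) = (- 1) ^ k" by simp
  then have "Gamma (of_nat k + 1 / 2 :: complex) * Gamma (1 / 2 - of_nat k) = of_real pi / (- 1) ^ k"
    using Gamma_reflection_complex[of "of_nat k + 1 / 2"] by (simp add: diff_diff_eq2[symmetric])
  then show ?thesis by (cases "even k") (simp_all add: mult.commute)
qed

lemma Gamma_half_minus: "Gamma (1 / 2 - of_nat k :: complex) = (- 1 / 2 - of_nat k) * Gamma (- 1 / 2 - of_nat k)"
proof -
  have "(- 1 / 2 - of_nat k :: complex) \<notin> \<int>\<^sub>\<le>\<^sub>0"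
  proof
    assume "(- 1 / 2 - of_nat k :: complex) \<in> \<int>\<^sub>\<le>\<^sub>0"
    then have "(- 1 / 2 - of_nat k :: complex) \<in> \<int>" by (rule nonpos_Ints_Int)
    then have "(- 1 / 2 - of_nat k :: complex) + of_nat k \<in> \<int>" by (intro Ints_add) auto
    then show False by simp
  qed
  from Gamma_plus1[OF this] show ?thesis by simp
qed

text \<open>By the reflection formula the two coefficients for charge c have product -4 c^2/(2k +
  1), which is the required value at c = 1/2. The factors h and 1/h cancel.\<close>

lemma heisenberg_hbar: "heisenberg pair_wt (hbar_der (der_coeff (1 / 2))) (hbar_mul (mul_coeff (1 / 2)))"
  unfolding hbar_der_def hbar_mul_def
proof (rule heisenberg_series)
  fix k
  have nz: "(of_nat k + 1 / 2 :: complex) \<noteq> 0"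
    by (rule of_nat_plus_half_nonzero)
  have g: "Gamma (1 / 2 - of_nat k :: complex) * Gamma (of_nat k + 3 / 2) = (of_nat k + 1 / 2) * ((- 1) ^ k * of_real pi)"
    using Gamma_half_reflection[of k] by (simp add: Gamma_plus_three_halves mult.left_commute mult.assoc)
  have s: "of_real (sqrt (2 * pi)) * of_real (sqrt (2 * pi)) = (2 * of_real pi :: complex)"
    by (simp only: of_real_mult[symmetric]) simp
  have "der_coeff (1 / 2) k * mul_coeff (1 / 2) k
    = 1 / 4 * (- 1) ^ (k + 1) * (of_real (sqrt (2 * pi)) * of_real (sqrt (2 * pi)))
      / (Gamma (1 / 2 - of_nat k) * Gamma (of_nat k + 3 / 2))"
    by (simp add: der_coeff_def mul_coeff_def)
  also have "\<dots> = - 1 / (2 * of_nat k + 1)"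
  proof -
    have "1 / 4 * (- e) * (2 * p) / (z * (e * p)) = - 1 / (2 * z)" if "z \<noteq> 0" "e \<noteq> 0" "p \<noteq> 0" for z e p :: complex
      using that by simp
    from this[of "of_nat k + 1 / 2" "(- 1) ^ k" "of_real pi"] nz show ?thesis
      unfolding g s by (simp add: distrib_left)
  qed
  finally have "of_nat (2 * k + 1) * (der_coeff (1 / 2) k * mul_coeff (1 / 2) k) = - 1"
    using nz by (simp add: field_simps)
  then have "fls_const (of_nat (2 * k + 1) * (der_coeff (1 / 2) k * mul_coeff (1 / 2) k)) = - 1"
    by (metis fls_const_1 fls_const_uminus)
  then have "of_nat (2 * k + 1) * (fls_const (der_coeff (1 / 2) k) * fls_const (mul_coeff (1 / 2) k)) = - 1"
    by (simp only: fls_of_nat fls_const_mult_const)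
  moreover have "x * fls_X * (y / fls_X) = x * y" for x y :: "complex fls"
    by (metis fls_X_nonzero nonzero_mult_div_cancel_left mult.assoc mult.commute times_divide_eq_right)
  ultimately show "of_nat (2 * k + 1) * (fls_const (der_coeff (1 / 2) k) * fls_X * (fls_const (mul_coeff (1 / 2) k) / fls_X)) = - 1"
    by (simp only:)
qed

interpretation heisenberg pair_wt "hbar_der (der_coeff (1 / 2))" "hbar_mul (mul_coeff (1 / 2))"
  by (rule heisenberg_hbar)

lemma hbar_der_uminus: "hbar_der (der_coeff (- c)) = - hbar_der (der_coeff c)"
  unfolding hbar_der_def der_series_uminus[symmetric]
  by (rule arg_cong[of _ _ der_series]) (simp add: der_coeff_def fls_const_uminus fun_eq_iff)

lemma hbar_mul_uminus: "hbar_mul (mul_coeff (- c)) = - hbar_mul (mul_coeff c)"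
  unfolding hbar_mul_def mul_series_uminus[symmetric]
  by (rule arg_cong[of _ _ mul_series])
     (simp only: mul_coeff_def fls_const_uminus fun_eq_iff mult_minus_left minus_divide_left simp_thms)

lemma hbar_der_add: "hbar_der (der_coeff (c + d)) = hbar_der (der_coeff c) + hbar_der (der_coeff d)"
  unfolding hbar_der_def der_series_add[symmetric]
  by (rule arg_cong[of _ _ der_series])
     (simp only: der_coeff_def distrib_right fls_plus_const[symmetric] fun_eq_iff simp_thms)

lemma hbar_mul_add: "hbar_mul (mul_coeff (c + d)) = hbar_mul (mul_coeff c) + hbar_mul (mul_coeff d)"
  unfolding hbar_mul_def mul_series_add[symmetric]
  by (rule arg_cong[of _ _ mul_series])
     (simp only: mul_coeff_def distrib_right fls_plus_const[symmetric] fun_eq_iff add_divide_distrib simp_thms)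

text \<open>Splitting the charge as 1 = 1/2 + 1/2 identifies :X(z) X(z): with the vertex operator of
  charges 1 and -1.\<close>

lemma expo_hbar_one:
  "fps_expo (hbar_der (der_coeff 1)) = E * E" "fps_expo (hbar_mul (mul_coeff 1)) = M * M"
proof -
  have "fps_expo (hbar_der (der_coeff (1 / 2 + 1 / 2))) = E * E"
    unfolding hbar_der_add E_def by (rule fps_expo_add) (simp_all add: A odd_fps_0)
  then show "fps_expo (hbar_der (der_coeff 1)) = E * E" by simp
  have "fps_expo (hbar_mul (mul_coeff (1 / 2 + 1 / 2))) = M * M"
    unfolding hbar_mul_add M_def by (rule fps_expo_add) (simp_all add: B odd_fps_0)
  then show "fps_expo (hbar_mul (mul_coeff 1)) = M * M" by simp
qed

lemma expo_hbar_uminus: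
  "fps_expo (hbar_der (der_coeff (- c))) = fps_alt (fps_expo (hbar_der (der_coeff c)))"
  "fps_expo (hbar_mul (mul_coeff (- c))) = fps_alt (fps_expo (hbar_mul (mul_coeff c)))"
  unfolding fps_alt_fps_expo hbar_der_uminus hbar_mul_uminus
  by (simp_all add: fps_alt_odd odd_der_series odd_mul_series hbar_der_def hbar_mul_def)

lemma bracket_alt: "bracket (fps_alt f) (fps_alt g) T G m = (if even T then 1 else - 1) * bracket f g T G m"
  unfolding bracket_def sum_distrib_left
  by (intro sum.cong refl) (simp add: int_nth_fps_alt app_uminus)

text \<open>Both exponents are odd in z, so exchanging the charges is the substitution of -z for z.
  Hence \<open>KP_reduction\<close> contains twice the odd part, and the sum in
  \<open>Omega_KW\<close> is twice an even part.\<close>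

lemma vertex2_uminus_nth:
  assumes "F = (\<lambda>m m'. fls_const (g (m, m')))"
  shows "vertex2 (- c) c F m m' $$ n = (if even n then 1 else - 1) * vertex2 c (- c) F m m' $$ n"
  using vertex2_nth[OF assms, of "- c" m m' n] vertex2_nth[OF assms, of c m m' n]
  by (simp only: expo_hbar_uminus bracket_alt minus_minus)

text \<open>\<phi> is the \<lambda>-derivative of the exponent for charge 1, twice that for charge
  1/2, and 2 d/d\<lambda> = z^(-2) (z d/dz). The factor 2k + 1 turns Gamma(k + 3/2) into Gamma(k +
  1/2).\<close>

lemma euler_hbar_mul: "euler (hbar_mul (mul_coeff (1 / 2))) = hbar_mul (\<lambda>k. 1 * (of_real (sqrt (2 * pi)) / Gamma (of_nat k + 1 / 2)))"
  unfolding hbar_mul_def euler_mul_series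
proof (rule arg_cong[of _ _ mul_series], rule ext)
  fix k
  have "2 * z * (1 / 2 * (s / (z * G))) = 1 * (s / G)" if "z \<noteq> 0" for z s G :: complex
    using that by simp
  moreover have "of_nat (2 * k + 1) = 2 * (of_nat k + 1 / 2 :: complex)" by simp
  ultimately have "of_nat (2 * k + 1) * mul_coeff (1 / 2) k = 1 * (of_real (sqrt (2 * pi)) / Gamma (of_nat k + 1 / 2))"
    unfolding mul_coeff_def Gamma_plus_three_halves using of_nat_plus_half_nonzero[of k] by (simp only:)
  then show "of_nat (2 * k + 1) * (fls_const (mul_coeff (1 / 2) k) / fls_X)
      = fls_const (1 * (of_real (sqrt (2 * pi)) / Gamma (of_nat k + 1 / 2))) / fls_X"
    by (metis fls_of_nat fls_const_mult_const times_divide_eq_right)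
qed

text \<open>The sign appears because z d/dz is minus the Euler operator on series in 1/z.\<close>

lemma euler_hbar_der: "- euler (hbar_der (der_coeff (1 / 2)))
    = hbar_der (\<lambda>k. 1 * ((- 1) ^ (k + 1) * (of_real (sqrt (2 * pi)) / Gamma (- 1 / 2 - of_nat k))))"
  unfolding hbar_der_def euler_der_series der_series_uminus[symmetric]
proof (rule arg_cong[of _ _ der_series], rule ext)
  fix k
  have "- (2 * - z * (1 / 2 * (e * (s / (z * G))))) = e * (s / G)" if "z \<noteq> 0" for z e s G :: complex
    using that by simp
  moreover have "of_nat (2 * k + 1) = 2 * - (- 1 / 2 - of_nat k :: complex)" by simp
  moreover have "(- 1 / 2 - of_nat k :: complex) \<noteq> 0"
  proof -
    have "(- 1 / 2 - of_nat k :: complex) = - (of_nat k + 1 / 2)" by simp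
    then show ?thesis using of_nat_plus_half_nonzero[of k] by (metis neg_equal_0_iff_equal)
  qed
  ultimately have "- (of_nat (2 * k + 1) * der_coeff (1 / 2) k) = (- 1) ^ (k + 1) * (of_real (sqrt (2 * pi)) / Gamma (- 1 / 2 - of_nat k))"
    unfolding der_coeff_def Gamma_half_minus by (simp only:)
  then have "fls_const (- (of_nat (2 * k + 1) * der_coeff (1 / 2) k))
      = fls_const (1 * ((- 1) ^ (k + 1) * (of_real (sqrt (2 * pi)) / Gamma (- 1 / 2 - of_nat k))))"
    by simp
  then show "- (of_nat (2 * k + 1) * (fls_const (der_coeff (1 / 2) k) * fls_X))
      = fls_const (1 * ((- 1) ^ (k + 1) * (of_real (sqrt (2 * pi)) / Gamma (- 1 / 2 - of_nat k)))) * fls_X"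
    by (simp only: fls_const_uminus[symmetric] fls_of_nat fls_const_mult_const mult.assoc[symmetric]
        mult_minus_left[symmetric])
qed

lemma period_phi_mul: "period (- int k) = cst (of_real (sqrt (2 * pi)) / Gamma (of_nat k + 1 / 2)) * w_power (2 - (2 * int k + 1))"
proof -
  have 1: "1 / 2 - of_int (- int k) = (of_nat k + 1 / 2 :: complex)" by simp
  have 2: "2 * (- int k) + 1 = 2 - (2 * int k + 1)" by simp
  show ?thesis unfolding period_def 1 2 ..
qed

lemma period_phi_der: "period (int k + 1) = cst (of_real (sqrt (2 * pi)) / Gamma (- 1 / 2 - of_nat k)) * w_power (2 * int k + 1 + 2)"
proof -
  have 1: "1 / 2 - of_int (int k + 1) = (- 1 / 2 - of_nat k :: complex)" by simp
  have 2: "2 * (int k + 1) + 1 = 2 * int k + 1 + 2" by simp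
  show ?thesis unfolding period_def 1 2 ..
qed

section \<open>Coefficients of the quadratic operator and of \<open>Omega_KW\<close>\<close>

context
  fixes F :: series2 and g :: "mono \<times> mono \<Rightarrow> complex fls"
  assumes F: "F = (\<lambda>m m'. fls_const (g (m, m')))"
begin

abbreviation (input) "\<alpha> \<equiv> euler (hbar_der (der_coeff (1 / 2)))"
abbreviation (input) "\<beta> \<equiv> euler (hbar_mul (mul_coeff (1 / 2)))"

lemma slice_F: "slice F n = app (1 $% n) g"
  by (auto simp: fun_eq_iff F slice_apply int_nth_1)

lemma phi_mult_nth:
  assumes "int (pair_wt (m, m')) \<le> W"
  shows "slice (phi_mult G) n (m, m') = (\<Sum>j\<in>{0..W}. app (\<beta> $% j) (slice G (n - 2 + j)) (m, m'))"
  unfolding phi_mult_def euler_hbar_mul by (rule mult_part_nth[OF period_phi_mul assms])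

lemma phi_deriv_nth:
  assumes "\<And>m m' n. n < 0 \<Longrightarrow> G m m' $$ n = 0"
  shows "slice (phi_deriv G) n (m, m') = (\<Sum>j\<in>{0..n}. app ((- \<alpha>) $% j) (slice G (n - 2 - j)) (m, m'))"
  unfolding phi_deriv_def euler_hbar_der by (rule deriv_part_nth[OF period_phi_der _ assms]) auto

lemma slice_phi_deriv_F: "slice (phi_deriv F) n = app ((- \<alpha>) $% (n - 2)) g"
proof
  fix i :: "mono \<times> mono"
  obtain m m' where i: "i = (m, m')" by fastforce
  have "slice (phi_deriv F) n (m, m') = (\<Sum>j\<in>{0..n}. app ((- \<alpha>) $% j) (slice F (n - 2 - j)) (m, m'))"
    by (rule phi_deriv_nth) (simp add: F)
  also have "\<dots> = app ((- \<alpha> * 1) $% (n - 2)) g (m, m')"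
    by (subst int_nth_mult_superset[of 0 "n - 2" n]) (simp_all add: slice_F app_sum app_mult)
  finally show "slice (phi_deriv F) n i = app ((- \<alpha>) $% (n - 2)) g i" by (simp add: i)
qed

lemma phi_deriv_phi_deriv_nth: "slice (phi_deriv (phi_deriv F)) n (m, m') = bracket 1 (\<alpha> * \<alpha>) (n - 4) g (m, m')"
proof -
  have "slice (phi_deriv (phi_deriv F)) n (m, m')
      = (\<Sum>j\<in>{0..n}. app ((- \<alpha>) $% j) (slice (phi_deriv F) (n - 2 - j)) (m, m'))"
  proof (rule phi_deriv_nth)
    show "phi_deriv F m m' $$ n = 0" if "n < 0" for m m' n
      using slice_phi_deriv_F[of n] that by (simp add: fun_eq_iff slice_def)
  qed
  also have "\<dots> = (\<Sum>j\<in>{0..n}. app ((- \<alpha>) $% j * (- \<alpha>) $% (n - 4 - j)) g (m, m'))"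
    by (intro sum.cong refl) (simp add: slice_phi_deriv_F app_mult diff_diff_eq add.commute)
  also have "\<dots> = app ((- \<alpha> * - \<alpha>) $% (n - 4)) g (m, m')"
    by (subst int_nth_mult_superset[of 0 "n - 4" n]) (simp_all add: app_sum)
  also have "\<dots> = (\<Sum>c\<in>{0..int (pair_wt (m, m'))}. if c = 0 then app ((\<alpha> * \<alpha>) $% (n - 4)) g (m, m') else 0)"
    by simp
  also have "\<dots> = bracket 1 (\<alpha> * \<alpha>) (n - 4) g (m, m')"
    unfolding bracket_def by (intro sum.cong refl) (simp add: int_nth_1)
  finally show ?thesis .
qed

lemma phi_mult_phi_deriv_nth: "slice (phi_mult (phi_deriv F)) n (m, m') = - bracket \<beta> \<alpha> (n - 4) g (m, m')"
proof -
  have "slice (phi_mult (phi_deriv F)) n (m, m') = bracket \<beta> (- \<alpha>) (n - 4) g (m, m')"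
    unfolding bracket_def phi_mult_nth[OF order_refl] slice_phi_deriv_F
    by (intro sum.cong refl) (simp add: app_mult algebra_simps)
  then show ?thesis
    by (simp add: bracket_def int_nth_uminus app_uminus sum_negf)
qed

lemma phi_mult_phi_mult_nth: "slice (phi_mult (phi_mult F)) n (m, m') = bracket (\<beta> * \<beta>) 1 (n - 4) g (m, m')"
proof -
  define W where "W = int (pair_wt (m, m'))"
  have gr: "graded (- 1) \<beta>" by (rule graded_euler[OF B(3)])
  have "slice (phi_mult (phi_mult F)) n (m, m') = (\<Sum>j\<in>{0..W}. app (\<beta> $% j) (slice (phi_mult F) (n - 2 + j)) (m, m'))"
    by (rule phi_mult_nth) (simp add: W_def)
  also have "\<dots> = (\<Sum>j\<in>{0..W}. \<Sum>a\<in>{0..W}. app (\<beta> $% j * \<beta> $% a) (slice F (n - 4 + (j + a))) (m, m'))"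
  proof (intro sum.cong refl)
    fix j assume j: "j \<in> {0..W}"
    have "app (\<beta> $% j) (slice (phi_mult F) (n - 2 + j)) (m, m')
       = app (\<beta> $% j) (\<lambda>i. \<Sum>a\<in>{0..W}. app (\<beta> $% a) (slice F (n - 4 + (j + a))) i) (m, m')"
    proof (rule homog_cong[OF graded_int[OF gr]])
      fix i assume "int (pair_wt i) = int (pair_wt (m, m')) + - 1 * j"
      then have "int (pair_wt (fst i, snd i)) \<le> W" using j by (simp add: W_def)
      from phi_mult_nth[OF this, of F "n - 2 + j"]
      show "slice (phi_mult F) (n - 2 + j) i = (\<Sum>a\<in>{0..W}. app (\<beta> $% a) (slice F (n - 4 + (j + a))) i)"
        by (simp add: algebra_simps)
    qed
    then show "app (\<beta> $% j) (slice (phi_mult F) (n - 2 + j)) (m, m')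
       = (\<Sum>a\<in>{0..W}. app (\<beta> $% j * \<beta> $% a) (slice F (n - 4 + (j + a))) (m, m'))"
      by (simp only: app_arg_sum app_mult)
  qed
  also have "\<dots> = (\<Sum>c\<in>{0..W}. app ((\<beta> * \<beta>) $% c) (slice F (n - 4 + c)) (m, m'))"
    by (rule conv_sum[OF gr gr]) (simp add: W_def)
  also have "\<dots> = bracket (\<beta> * \<beta>) 1 (n - 4) g (m, m')"
    unfolding bracket_def W_def slice_F by (intro sum.cong refl) (simp add: app_mult add.commute)
  finally show ?thesis .
qed

text \<open>Each \<phi> brings a factor w^2, hence the index n - 4; the negative middle term
  reflects the sign in \<open>euler_hbar_der\<close>.\<close>

lemma phi_normal_square_nth:
  "phi_normal_square F m m' $$ n
    = bracket (\<beta> * \<beta>) 1 (n - 4) g (m, m') - 2 * bracket \<beta> \<alpha> (n - 4) g (m, m') + bracket 1 (\<alpha> * \<alpha>) (n - 4) g (m, m')"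
proof -
  have "(2 * f) $$ n = 2 * f $$ n" for f :: coef
    by (simp only: mult_2 fls_plus_nth)
  then show ?thesis
    unfolding phi_normal_square_def
    using phi_mult_phi_mult_nth[of n m m'] phi_mult_phi_deriv_nth[of n m m'] phi_deriv_phi_deriv_nth[of n m m']
    by (simp add: slice_apply)
qed

lemma int_nth_odd_fps: "odd_fps f \<Longrightarrow> even n \<Longrightarrow> f $% n = 0"
  by (auto simp: int_nth_def odd_fps_def even_nat_iff)

lemma bracket_odd_eq_0:
  assumes "odd T"
  shows "bracket (\<beta> * \<beta>) 1 T g m = 0" "bracket \<beta> \<alpha> T g m = 0" "bracket 1 (\<alpha> * \<alpha>) T g m = 0"
proof -
  have odd: "odd_fps \<alpha>" "odd_fps \<beta>"
    using odd_fps_euler[OF A(1)] odd_fps_euler[OF B(1)] .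
  have sq: "(f * f) $% n = 0" if "odd_fps f" "odd n" for f :: "(mono \<times> mono, complex fls) endo fps" and n
    unfolding int_nth_mult
  proof (intro sum.neutral ballI)
    fix i
    have "even i \<or> even (n - i)" using that(2) by simp
    then show "f $% i * f $% (n - i) = 0" using int_nth_odd_fps[OF that(1)] by auto
  qed
  show "bracket (\<beta> * \<beta>) 1 T g m = 0"
    unfolding bracket_def
  proof (intro sum.neutral ballI)
    fix c
    have "c + T \<noteq> 0 \<or> odd c" using assms by presburger
    then show "app ((\<beta> * \<beta>) $% c * 1 $% (c + T)) g m = 0"
      using sq[OF odd(2)] by (auto simp: int_nth_1)
  qed
  show "bracket 1 (\<alpha> * \<alpha>) T g m = 0"
    unfolding bracket_def using sq[OF odd(1) assms] by (intro sum.neutral ballI) (auto simp: int_nth_1)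
  show "bracket \<beta> \<alpha> T g m = 0"
    unfolding bracket_def
  proof (intro sum.neutral ballI)
    fix c
    have "even c \<or> even (c + T)" using assms by simp
    then show "app (\<beta> $% c * \<alpha> $% (c + T)) g m = 0"
      using int_nth_odd_fps[OF odd(1)] int_nth_odd_fps[OF odd(2)] by auto
  qed
qed

text \<open>For odd n the two vertex operators cancel and the quadratic part vanishes by parity. For
  even n > 0 the index T = n - 4 is at least -2, the range of \<open>bilinear_identity\<close>, and
  X - d = 2 J gives 2 X/16 - J/4 - d/8 = 0.\<close>

lemma Omega_nth_eq_0:
  assumes KP: "\<And>m m' j. odd j \<Longrightarrow> j > 0 \<Longrightarrow> vertex2 (1 / 2) (- (1 / 2)) F m m' $$ j = 0"
    and n: "n > 0 \<or> odd n"
  shows "Omega_KW F m m' $$ n = 0"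
proof -
  define T where "T = n - 4"
  define X where "X = bracket (M * M) (E * E) T g (m, m')"
  define J where "J = bracket (\<beta> * \<beta>) 1 T g (m, m') - 2 * bracket \<beta> \<alpha> T g (m, m') + bracket 1 (\<alpha> * \<alpha>) T g (m, m')"
  define d where "d = (if T = 0 then g (m, m') else 0)"
  have v: "vertex2 1 (- 1) F m m' $$ T = X"
    using vertex2_nth[OF F, of 1 m m' T] by (simp add: X_def expo_hbar_one)
  have v': "vertex2 (- 1) 1 F m m' $$ T = (if even T then 1 else - 1) * X"
    using vertex2_uminus_nth[OF F, of 1 m m' T] v by simp
  have "F m m' $$ T = d" by (simp add: F d_def)
  then have Om: "Omega_KW F m m' $$ n = fls_const (1 / 16) * (X + (if even T then 1 else - 1) * X)
      - (fls_const (1 / 4) * J + fls_const (1 / 8) * d)"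
    using phi_normal_square_nth[of m m' n] v v'
    by (simp add: Omega_KW_def L_op_def mult.assoc cst_nth w_power_nth T_def[symmetric] J_def)
  show ?thesis
  proof (cases "even T")
    case False
    then have "J = 0" "d = 0" by (auto simp: J_def d_def bracket_odd_eq_0)
    with False Om show ?thesis by simp
  next
    case True
    have "T \<ge> - 2" using True n by (auto simp: T_def elim!: evenE)
    have "bracket M E j g i = 0" if "odd j" "j > 0" for j i
      using KP[OF that, of "fst i" "snd i"] vertex2_nth[OF F, of "1 / 2" "fst i" "snd i" j]
      by (simp add: M_def E_def)
    from bilinear_identity[OF this True \<open>T \<ge> - 2\<close>, of "(m, m')"] have "X - d = 2 * J"
      by (simp add: X_def d_def J_def)
    then have X: "X = d + 2 * J" by (simp add: algebra_simps)
    have c: "fls_const (1 / 4) = fls_const (1 / 8) * (2 :: complex fls)" "fls_const (1 / 8) = fls_const (1 / 16) * (2 :: complex fls)"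
      by (simp_all flip: fls_const_numeral)
    have "X + (if even T then 1 else - 1) * X = 2 * X" using True by simp
    then show ?thesis unfolding Om X c by (simp add: algebra_simps)
  qed
qed

end

section \<open>Regularity as vanishing of coefficients, and the conclusion\<close>

lemma lambda_var_mult_nth: "(lambda_var u * f) $$ j = u * f $$ j + f $$ (j + 2)"
  using fls_X_intpow_times_conv_shift(1)[of "- 2" f] by (simp add: lambda_var_def distrib_right)

lemma poly_lambda_var_nth_eq_0:
  assumes "j > 0 \<or> odd j"
  shows "poly (map_poly fls_const p) (lambda_var u) $$ j = 0"
  using assms
proof (induction p arbitrary: j)
  case (pCons a p)
  then have "poly (map_poly fls_const p) (lambda_var u) $$ (j + 2) = 0"
    by (intro pCons.IH) auto
  with pCons show ?case
    by (auto simp: map_poly_pCons lambda_var_mult_nth)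
qed simp

lemma ex_poly_lambda_var:
  "\<exists>p. poly (map_poly fls_const p) (lambda_var u) = (\<Sum>i<N. fls_const (a i) * fls_X_intpow (- 2 * int i))"
proof (induction N arbitrary: a)
  case 0
  show ?case by (rule exI[of _ 0]) simp
next
  case (Suc N)
  from Suc[of "\<lambda>i. a (Suc i)"] obtain p where
    p: "poly (map_poly fls_const p) (lambda_var u) = (\<Sum>i<N. fls_const (a (Suc i)) * fls_X_intpow (- 2 * int i))" ..
  \<comment> \<open>q is a 0 + (x - u) p in the polynomial variable x; since \<lambda> - u = w^(-2),
    multiplying by x - u moves the coefficient of w^(-2i) to w^(-2i - 2).\<close>
  define q where "q = pCons (a 0) p - smult u p"
  have q: "map_poly fls_const q = pCons (fls_const (a 0)) (map_poly fls_const p) - smult (fls_const u) (map_poly fls_const p)"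
    by (rule poly_eqI) (auto simp: q_def coeff_map_poly coeff_pCons fls_minus_const[symmetric] split: nat.split)
  have "poly (map_poly fls_const q) (lambda_var u)
      = fls_const (a 0) + fls_X_intpow (- 2) * poly (map_poly fls_const p) (lambda_var u)"
    unfolding q by (simp add: lambda_var_def algebra_simps)
  also have "\<dots> = (\<Sum>i<Suc N. fls_const (a i) * fls_X_intpow (- 2 * int i))"
    unfolding p sum.lessThan_Suc_shift sum_distrib_left
    by (auto simp: fls_X_intpow_times_conv_shift fls_shifted_times_simps algebra_simps intro!: sum.cong)
  finally show ?case by blast
qed

text \<open>Since \<lambda> - u = w^(-2), a polynomial in \<lambda> is a finite sum of even
  nonpositive powers of w, whatever u is. Conversely, the order in w of a coefficient is bounded
  below, which bounds the degree.\<close>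

lemma regular_in_lambda_iff:
  "regular_in_lambda u F \<longleftrightarrow> (\<forall>m m' j. j > 0 \<or> odd j \<longrightarrow> F m m' $$ j = 0)"
proof
  assume *: "regular_in_lambda u F"
  show "\<forall>m m' j. j > 0 \<or> odd j \<longrightarrow> F m m' $$ j = 0"
  proof (intro allI impI fls_eqI)
    fix m m' j n assume j: "j > (0::int) \<or> odd j"
    from * obtain p where "F m m' $$ j $$ n = poly (map_poly fls_const p) (lambda_var u) $$ j"
      unfolding regular_in_lambda_def by blast
    then show "F m m' $$ j $$ n = 0 $$ n" using poly_lambda_var_nth_eq_0[OF j] by simp
  qed
next
  assume *: "\<forall>m m' j. j > 0 \<or> odd j \<longrightarrow> F m m' $$ j = 0"
  show "regular_in_lambda u F"
    unfolding regular_in_lambda_def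
  proof (intro allI)
    fix m m' n
    define N where "N = Suc (nat (- fls_subdegree (F m m')))"
    obtain p where p: "poly (map_poly fls_const p) (lambda_var u)
        = (\<Sum>i<N. fls_const (F m m' $$ (- 2 * int i) $$ n) * fls_X_intpow (- 2 * int i))"
      using ex_poly_lambda_var[where a = "\<lambda>i. F m m' $$ (- 2 * int i) $$ n"] by blast
    have "F m m' $$ j $$ n = poly (map_poly fls_const p) (lambda_var u) $$ j" for j
    proof -
      have "poly (map_poly fls_const p) (lambda_var u) $$ j
          = (\<Sum>i<N. if j = - 2 * int i then F m m' $$ j $$ n else 0)"
        unfolding p by (auto simp: fls_nth_sum intro!: sum.cong)
      also have "\<dots> = F m m' $$ j $$ n"
      proof (cases "j > 0 \<or> odd j \<or> j < fls_subdegree (F m m')")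
        case True
        then have "F m m' $$ j = 0" using * by auto
        then show ?thesis by (intro trans[OF sum.neutral]) auto
      next
        case False
        define k where "k = nat (- j div 2)"
        have k: "j = - 2 * int k" using False by (auto simp: k_def not_less elim!: evenE)
        have "k < N" using False k by (auto simp: N_def)
        have "(\<Sum>i<N. if j = - 2 * int i then F m m' $$ j $$ n else 0) = (\<Sum>i<N. if i = k then F m m' $$ j $$ n else 0)"
          by (intro sum.cong refl) (auto simp: k)
        then show ?thesis using \<open>k < N\<close> by simp
      qed
      finally show ?thesis ..
    qed
    then show "\<exists>p. \<forall>j. F m m' $$ j $$ n = poly (map_poly fls_const p) (lambda_var u) $$ j" by blast
  qed
qed

theorem proposition6p1:
  fixes u :: complex and A :: "mono \<Rightarrow> complex fls"
  assumes "A \<in> formal_functions"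
    and "regular_in_lambda u (KP_reduction (tensor_square A))"
  shows "regular_in_lambda u (Omega_KW (tensor_square A))"
proof -
  define g where "g = (\<lambda>(m, m'). fls_compose_power (A m * A m') 2)"
  define F where "F = tensor_square A"
  have F: "F = (\<lambda>m m'. fls_const (g (m, m')))"
    by (simp add: F_def g_def tensor_square_def)
  have "vertex2 (1 / 2) (- (1 / 2)) F m m' $$ j = 0" if "odd j" "j > 0" for m m' j
  proof -
    \<comment> \<open>The prefactor w moves odd j to the even index j + 1, so it is the absence of
      positive powers, not parity, that gives the condition on the vertex operator.\<close>
    have "KP_reduction F m m' $$ (j + 1) = 0"
      using assms(2) that unfolding regular_in_lambda_iff F_def by auto
    moreover have "KP_reduction F m m' $$ (j + 1) = 2 * vertex2 (1 / 2) (- (1 / 2)) F m m' $$ j"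
      using vertex2_uminus_nth[OF F, of "1 / 2" m m' j] that
      by (simp add: KP_reduction_def w_power_nth)
    ultimately show ?thesis by simp
  qed
  then show ?thesis
    unfolding regular_in_lambda_iff F_def[symmetric] using Omega_nth_eq_0[OF F] by blast
qed

end
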